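(* Let $(X,\mathfrak{B})$ and $r\colon X\to X$ be as in the context. Let $V\colon X\to[0,\infty)$ be bounded and measurable. Let $\hat\mu\in M_{qi,1}^V(X_\infty(r))$ and $\mu_0:=\hat\mu\circ\theta_0^{-1}\in M_1^V(X)$. The following assertions are equivalent: (i) $\hat\mu$ is an extreme point of $M_{qi,1}^V(X_\infty(r))$; (ii) $V\circ\theta_0\,d\hat\mu$ is ergodic with respect to $\hat r$; (iii) $\mu_0$ is an extreme point of $M_1^V(X)$; (iv) $\mu_0$ is relatively ergodic with respect to $(r,V)$.
   Context: $X$ is a non-empty set, $\mathfrak{B}$ a $\sigma$-algebra of subsets of $X$, and $r\colon X\to X$ an onto, finite-to-one, $\mathfrak{B}$-measurable map whose inverse branches can be labelled measurably: $\mathfrak{c}(x)=\#\,r^{-1}(x)$ is measurable, and with $A_i=\{x\mid\mathfrak{c}(x)\ge i\}$ there are measurable maps $\tau_i\colon A_i\to X$ with $r^{-1}(x)=\{\tau_1(x),\dots,\tau_{\mathfrak{c}(x)}(x)\}$ (without repetitions) and $\tau_i(A_i)\in\mathfrak{B}$. $X_\infty(r)=\{(x_0,x_1,\dots)\in\prod_{n\ge0}X\mid r(x_{n+1})=x_n\ \forall n\ge0\}$, $\theta_n(x_0,x_1,\dots)=x_n$, $\mathfrak{B}_\infty$ is the $\sigma$-algebra generated by all $\theta_n^{-1}(\mathfrak{B})$, and $\hat r(x_0,x_1,\dots)=(r(x_0),x_0,x_1,\dots)$, a measurable bijection; $(\hat\mu\circ\hat r)(E)=\hat\mu(\hat r(E))$.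 $M_1^V(X)$ is the convex set of probability measures $\mu$ on $(X,\mathfrak{B})$ with $d\mu=(V\,d\mu)\circ r^{-1}$ (the push-forward of $V\,d\mu$ under $r$), and $M_{qi,1}^V(X_\infty(r))$ is the convex set of probability measures $\hat\mu$ on $(X_\infty(r),\mathfrak{B}_\infty)$ with $\hat\mu\circ\hat r\ll\hat\mu$ and $\frac{d(\hat\mu\circ\hat r)}{d\hat\mu}=V\circ\theta_0$. A measure $\sigma$ on $X_\infty(r)$ is ergodic with respect to $\hat r$ if every bounded measurable $f$ with $f=f\circ\hat r$ $\sigma$-a.e. is constant $\sigma$-a.e. A measure $\mu_0\in M_1^V(X)$ is relatively ergodic with respect to $(r,V)$ if the only non-negative, bounded $\mathfrak{B}$-measurable functions $f$ on $X$ satisfying $E_{\mu_0}(Vf)=E_{\mu_0}(V)\,f\circ r$ $\mu_0$-a.e. are the functions which are constant $\mu_0$-a.e.; here $E_{\mu_0}$ is the conditional expectation, with respect to $\mu_0$, onto the $\sigma$-algebra $r^{-1}(\mathfrak{B})$. *)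

theory Defs
  imports "HOL-Probability.Probability"
begin

text \<open>
  The measurable space $(X, \mathfrak{B})$ is a value \<open>M\<close> of type \<^typ>\<open>'a measure\<close>, of which only
  \<^term>\<open>space M\<close> and \<^term>\<open>sets M\<close> matter. A measure on it is a \<open>\<mu>\<close> with \<^prop>\<open>sets \<mu> = sets M\<close>.
\<close>

definition fibre :: "'a measure \<Rightarrow> ('a \<Rightarrow> 'a) \<Rightarrow> 'a \<Rightarrow> 'a set" where
  "fibre M r x = {y \<in> space M. r y = x}"

definition branch_dom :: "'a measure \<Rightarrow> ('a \<Rightarrow> 'a) \<Rightarrow> nat \<Rightarrow> 'a set" where
  "branch_dom M r i = {x \<in> space M. i \<le> card (fibre M r x)}"

locale finite_to_one_endo =
  fixes M :: "'a measure" and r :: "'a \<Rightarrow> 'a"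
  assumes space_nonempty: "space M \<noteq> {}"
    and r_measurable: "r \<in> measurable M M"
    and r_onto: "r ` space M = space M"
    and finite_fibre: "\<And>x. x \<in> space M \<Longrightarrow> finite (fibre M r x)"
    and card_fibre_measurable: "(\<lambda>x. card (fibre M r x)) \<in> measurable M (count_space UNIV)"
    and measurable_branches: "\<exists>\<tau> :: nat \<Rightarrow> 'a \<Rightarrow> 'a.
      (\<forall>i\<ge>1. \<tau> i \<in> measurable (restrict_space M (branch_dom M r i)) M
            \<and> \<tau> i ` branch_dom M r i \<in> sets M) \<and>
      (\<forall>x\<in>space M. bij_betw (\<lambda>i. \<tau> i x) {1..card (fibre M r x)} (fibre M r x))"

definition solenoid :: "'a measure \<Rightarrow> ('a \<Rightarrow> 'a) \<Rightarrow> (nat \<Rightarrow> 'a) set" where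
  "solenoid M r = {x. (\<forall>n. x n \<in> space M) \<and> (\<forall>n. r (x (Suc n)) = x n)}"

text \<open>
  The coordinate map $\theta_n$ is evaluation at \<open>n\<close>. As for \<open>M\<close>, only \<^const>\<open>space\<close> and \<^const>\<open>sets\<close>
  of the following are meaningful.
\<close>

definition solenoid_algebra :: "'a measure \<Rightarrow> ('a \<Rightarrow> 'a) \<Rightarrow> (nat \<Rightarrow> 'a) measure" where
  "solenoid_algebra M r =
     sigma (solenoid M r) {(\<lambda>x. x n) -` A \<inter> solenoid M r | n A. A \<in> sets M}"

definition rhat :: "('a \<Rightarrow> 'a) \<Rightarrow> (nat \<Rightarrow> 'a) \<Rightarrow> (nat \<Rightarrow> 'a)" where
  "rhat r x = case_nat (r (x 0)) x"

text \<open>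
  The set function $E \mapsto \mu(T(E))$. By the convention of \<^const>\<open>measure_of\<close> this is the zero measure
  if the set function is not a measure; lemma \<open>emeasure_comp_rhat\<close> below rules this out for
  \<^const>\<open>rhat\<close>.
\<close>

definition comp_measure :: "'b measure \<Rightarrow> ('b \<Rightarrow> 'b) \<Rightarrow> 'b measure" where
  "comp_measure \<mu> T = measure_of (space \<mu>) (sets \<mu>) (\<lambda>E. emeasure \<mu> (T ` E))"

definition M1 :: "'a measure \<Rightarrow> ('a \<Rightarrow> 'a) \<Rightarrow> ('a \<Rightarrow> real) \<Rightarrow> 'a measure set" where
  "M1 M r V = {\<mu>. prob_space \<mu> \<and> sets \<mu> = sets M \<and>
     \<mu> = distr (density \<mu> (\<lambda>x. ennreal (V x))) M r}"

definition Mqi1 :: "'a measure \<Rightarrow> ('a \<Rightarrow> 'a) \<Rightarrow> ('a \<Rightarrow> real) \<Rightarrow> (nat \<Rightarrow> 'a) measure set" where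
  "Mqi1 M r V = {\<mu>. prob_space \<mu> \<and> sets \<mu> = sets (solenoid_algebra M r) \<and>
     absolutely_continuous \<mu> (comp_measure \<mu> (rhat r)) \<and>
     (AE x in \<mu>. RN_deriv \<mu> (comp_measure \<mu> (rhat r)) x = ennreal (V (x 0)))}"

text \<open>
  Measures do not form a vector space in the library, so \<^const>\<open>extreme_point_of\<close> is not applicable.
  This is its definition, with convex combinations taken setwise; it is meant for sets \<open>S\<close> of
  probability measures on one common \<open>\<sigma>\<close>-algebra.
\<close>

definition extreme_measure :: "'b measure \<Rightarrow> 'b measure set \<Rightarrow> bool" where
  "extreme_measure \<mu> S \<longleftrightarrow> \<mu> \<in> S \<and>
     (\<forall>\<nu>\<^sub>1\<in>S. \<forall>\<nu>\<^sub>2\<in>S. \<forall>t. 0 < t \<and> t < 1 \<and>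
        (\<forall>A\<in>sets \<mu>. measure \<mu> A = (1 - t) * measure \<nu>\<^sub>1 A + t * measure \<nu>\<^sub>2 A)
        \<longrightarrow> \<nu>\<^sub>1 = \<nu>\<^sub>2)"

definition ergodic :: "'b measure \<Rightarrow> ('b \<Rightarrow> 'b) \<Rightarrow> bool" where
  "ergodic \<sigma> T \<longleftrightarrow>
     (\<forall>f :: 'b \<Rightarrow> real. f \<in> borel_measurable \<sigma> \<and> bounded (f ` space \<sigma>) \<and>
        (AE x in \<sigma>. f x = f (T x)) \<longrightarrow> (\<exists>c. AE x in \<sigma>. f x = c))"

definition relatively_ergodic ::
    "'a measure \<Rightarrow> ('a \<Rightarrow> 'a) \<Rightarrow> ('a \<Rightarrow> real) \<Rightarrow> 'a measure \<Rightarrow> bool" where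
  "relatively_ergodic M r V \<mu> \<longleftrightarrow> \<mu> \<in> M1 M r V \<and>
     (let E = real_cond_exp \<mu> (vimage_algebra (space M) r M) in
      \<forall>f :: 'a \<Rightarrow> real.
        f \<in> borel_measurable M \<and> (\<forall>x\<in>space M. 0 \<le> f x) \<and> bounded (f ` space M) \<and>
        (AE x in \<mu>. E (\<lambda>y. V y * f y) x = E V x * f (r x))
        \<longrightarrow> (\<exists>c. AE x in \<mu>. f x = c))"

lemma space_solenoid_algebra: "space (solenoid_algebra M r) = solenoid M r"
  unfolding solenoid_algebra_def by (rule space_measure_of) auto

lemma measurable_coord: "(\<lambda>x. x n) \<in> measurable (solenoid_algebra M r) M"
proof (rule measurableI)
  fix A assume "A \<in> sets M"
  then show "(\<lambda>x. x n) -` A \<inter> space (solenoid_algebra M r) \<in> sets (solenoid_algebra M r)"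
    unfolding space_solenoid_algebra unfolding solenoid_algebra_def
    by (subst sets_measure_of) (auto intro!: sigma_sets.Basic)
qed (auto simp: space_solenoid_algebra solenoid_def)

lemma measurable_solenoidI:
  assumes "\<And>x. x \<in> space N \<Longrightarrow> f x \<in> solenoid M r"
    and "\<And>n. (\<lambda>x. f x n) \<in> measurable N M"
  shows "f \<in> measurable N (solenoid_algebra M r)"
  unfolding solenoid_algebra_def
proof (rule measurable_sigma_sets)
  show "sets (sigma (solenoid M r) {(\<lambda>x. x n) -` A \<inter> solenoid M r |n A. A \<in> sets M})
      = sigma_sets (solenoid M r) {(\<lambda>x. x n) -` A \<inter> solenoid M r |n A. A \<in> sets M}"
    by (rule sets_measure_of) auto
  fix Y assume "Y \<in> {(\<lambda>x. x n) -` A \<inter> solenoid M r |n A. A \<in> sets M}"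
  then obtain n A where A: "A \<in> sets M" and Y: "Y = (\<lambda>x. x n) -` A \<inter> solenoid M r" by auto
  have "f -` Y \<inter> space N = (\<lambda>x. f x n) -` A \<inter> space N"
    using assms(1) Y by auto
  then show "f -` Y \<inter> space N \<in> sets N"
    using measurable_sets[OF assms(2) A] by simp
qed (use assms(1) in auto)

context finite_to_one_endo
begin

lemma rhat_in: "x \<in> solenoid M r \<Longrightarrow> rhat r x \<in> solenoid M r"
  using measurable_space[OF r_measurable]
  by (auto simp: solenoid_def rhat_def split: nat.split)

lemma rhat_tail: "x \<in> solenoid M r \<Longrightarrow> rhat r (\<lambda>n. x (Suc n)) = x"
  by (auto simp: solenoid_def rhat_def fun_eq_iff split: nat.split)

lemma tail_rhat: "(\<lambda>n. rhat r x (Suc n)) = x"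
  by (simp add: rhat_def)

lemma tail_in: "x \<in> solenoid M r \<Longrightarrow> (\<lambda>n. x (Suc n)) \<in> solenoid M r"
  by (auto simp: solenoid_def)

lemma measurable_rhat: "rhat r \<in> measurable (solenoid_algebra M r) (solenoid_algebra M r)"
proof (rule measurable_solenoidI)
  fix n show "(\<lambda>x. rhat r x n) \<in> measurable (solenoid_algebra M r) M"
    by (cases n) (auto simp: rhat_def intro: measurable_coord measurable_compose[OF _ r_measurable])
qed (auto simp: space_solenoid_algebra rhat_in)

lemma measurable_tail:
  "(\<lambda>x n. x (Suc n)) \<in> measurable (solenoid_algebra M r) (solenoid_algebra M r)"
  by (rule measurable_solenoidI) (auto simp: space_solenoid_algebra tail_in intro: measurable_coord)

lemma bij_betw_rhat: "bij_betw (rhat r) (solenoid M r) (solenoid M r)"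
  by (rule bij_betwI[where g = "\<lambda>x n. x (Suc n)"])
    (auto simp: rhat_in tail_in rhat_tail tail_rhat)

lemma rhat_image:
  assumes "E \<subseteq> solenoid M r"
  shows "rhat r ` E = (\<lambda>x n. x (Suc n)) -` E \<inter> solenoid M r"
proof (intro equalityI subsetI)
  fix x assume "x \<in> (\<lambda>x n. x (Suc n)) -` E \<inter> solenoid M r"
  then show "x \<in> rhat r ` E"
    using rhat_tail[of x] by (auto intro!: image_eqI[where x = "\<lambda>n. x (Suc n)"])
qed (use assms in \<open>auto simp: tail_rhat rhat_in\<close>)

lemma comp_rhat_eq_distr:
  assumes s: "sets \<mu> = sets (solenoid_algebra M r)"
  shows "comp_measure \<mu> (rhat r) = distr \<mu> (solenoid_algebra M r) (\<lambda>x n. x (Suc n))"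
proof -
  have sp: "space \<mu> = solenoid M r"
    using sets_eq_imp_space_eq[OF s] by (simp add: space_solenoid_algebra)
  have "measure_of (space \<mu>) (sets \<mu>) (\<lambda>E. emeasure \<mu> (rhat r ` E)) =
      measure_of (space \<mu>) (sets \<mu>) (\<lambda>E. emeasure \<mu> ((\<lambda>x n. x (Suc n)) -` E \<inter> space \<mu>))"
  proof (rule measure_of_eq)
    show "sets \<mu> \<subseteq> Pow (space \<mu>)" by (rule sets.space_closed)
    fix E assume "E \<in> sigma_sets (space \<mu>) (sets \<mu>)"
    then have "E \<in> sets \<mu>" by (simp add: sets.sigma_sets_eq)
    then have "E \<subseteq> solenoid M r" using sets.sets_into_space sp by blast
    then show "emeasure \<mu> (rhat r ` E) = emeasure \<mu> ((\<lambda>x n. x (Suc n)) -` E \<inter> space \<mu>)"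
      by (simp add: rhat_image sp)
  qed
  then show ?thesis
    unfolding comp_measure_def distr_def using s sp by (simp add: space_solenoid_algebra)
qed

lemma emeasure_comp_rhat:
  assumes "sets \<mu> = sets (solenoid_algebra M r)" and "E \<in> sets \<mu>"
  shows "emeasure (comp_measure \<mu> (rhat r)) E = emeasure \<mu> (rhat r ` E)"
proof -
  have sp: "space \<mu> = solenoid M r"
    using sets_eq_imp_space_eq[OF assms(1)] by (simp add: space_solenoid_algebra)
  have "(\<lambda>x n. x (Suc n)) \<in> measurable \<mu> (solenoid_algebra M r)"
    using measurable_tail by (simp add: measurable_cong_sets[OF assms(1) refl])
  moreover have "E \<subseteq> solenoid M r" using sets.sets_into_space[OF assms(2)] sp by blast
  ultimately show ?thesis
    using assms by (simp add: comp_rhat_eq_distr emeasure_distr rhat_image sp)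
qed

end

end

theory Submission
  imports Defs
begin

text \<open>
  The condition defining \<^const>\<open>Mqi1\<close> says that \<open>\<mu>\<close> is the push-forward of \<open>V \<circ> \<theta>\<^sub>0 d\<mu>\<close> under
  \<open>rhat r\<close>, so \<^const>\<open>Mqi1\<close> is an instance of \<^const>\<open>M1\<close>. For every set \<open>M1 N R W\<close>, an extreme point is the
  same as a \<open>\<mu>\<close> that is the only element bounded by a multiple of \<open>\<mu>\<close>, and also the same as a
  relatively ergodic \<open>\<mu>\<close>: the bounded densities \<open>f\<close> with \<open>f d\<mu>\<close> again in the set are those with
  \<open>E(W f) = E(W) (f \<circ> R)\<close>. As \<open>rhat r\<close> is invertible, \<open>E\<close> is the identity on the solenoid and
  relative ergodicity becomes ergodicity of \<open>V \<circ> \<theta>\<^sub>0 d\<mu>\<close>.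

  To compare \<open>X\<close> with the solenoid, note that the \<open>\<theta>\<^sub>0\<close>-marginal determines all marginals. Conversely,
  if \<open>f d\<mu>\<^sub>0\<close> is in the set, with \<open>f\<close> bounded, then the \<open>f \<circ> \<theta>\<^sub>n\<close> form a martingale under \<open>\<mu>\<close>; the
  measures \<open>(f \<circ> \<theta>\<^sub>n) d\<mu>\<close> are eventually constant on each cylinder and bounded by a multiple of \<open>\<mu>\<close>, so
  they define, by Caratheodory's theorem, a measure on the solenoid with marginal \<open>f d\<mu>\<^sub>0\<close>.
\<close>

subsection \<open>Extreme points and relative ergodicity\<close>

text \<open>Instantiated twice: by \<open>r\<close> with weight \<open>V\<close> on the base space
  and by \<open>rhat r\<close> with weight \<open>V (x 0)\<close> on the solenoid.\<close>

locale weighted_endo =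
  fixes N :: "'b measure" and R :: "'b \<Rightarrow> 'b" and W :: "'b \<Rightarrow> real"
  assumes R_measurable [measurable]: "R \<in> measurable N N"
    and W_measurable [measurable]: "W \<in> borel_measurable N"
    and W_nonneg: "\<And>x. x \<in> space N \<Longrightarrow> 0 \<le> W x"
    and W_bounded: "bounded (W ` space N)"

section \<open>Bounded functions and bounded densities\<close>

lemma bounded_imageE:
  fixes f :: "'b \<Rightarrow> real"
  assumes "bounded (f ` S)"
  obtains K where "0 < K" "\<And>x. x \<in> S \<Longrightarrow> \<bar>f x\<bar> \<le> K"
  using assms bounded_pos[of "f ` S"] by auto

lemma (in finite_measure) integrable_bounded_image:
  fixes f :: "'a \<Rightarrow> real"
  assumes "f \<in> borel_measurable M" "bounded (f ` space M)"
  shows "integrable M f"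
proof -
  obtain K where "\<And>x. x \<in> space M \<Longrightarrow> \<bar>f x\<bar> \<le> K"
    using bounded_imageE[OF assms(2)] by blast
  then show ?thesis
    using assms(1) by (intro integrable_const_bound[where B = K]) auto
qed

text \<open>The Radon-Nikodym density has averages \<open>measure \<nu> A / measure \<mu> A\<close>
  over sets of positive measure, all at most \<open>C\<close>. The averaging theorem then puts the
  density itself below \<open>C\<close> almost everywhere, and truncation makes the bound hold at
  every point.\<close>

lemma dominated_density:
  assumes "finite_measure \<mu>" "finite_measure \<nu>" "sets \<nu> = sets \<mu>"
    and dom: "\<And>A. A \<in> sets \<mu> \<Longrightarrow> measure \<nu> A \<le> C * measure \<mu> A"
  obtains f :: "'b \<Rightarrow> real" where "f \<in> borel_measurable \<mu>" "\<And>x. 0 \<le> f x"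
    "bounded (range f)" "\<nu> = density \<mu> f"
proof -
  interpret \<mu>: finite_measure \<mu> by fact
  interpret \<nu>: finite_measure \<nu> by fact
  have ac: "absolutely_continuous \<mu> \<nu>"
    unfolding absolutely_continuous_def
  proof
    fix A assume A: "A \<in> null_sets \<mu>"
    then have "measure \<nu> A \<le> 0" using dom[of A] by (auto simp: null_sets_def measure_def)
    then show "A \<in> null_sets \<nu>"
      using A assms(3) by (auto simp: null_sets_def \<nu>.emeasure_eq_measure measure_le_0_iff)
  qed
  obtain D where D [measurable]: "D \<in> borel_measurable \<mu>"
    and RN: "AE x in \<mu>. RN_deriv \<mu> \<nu> x = ennreal (D x)" and D0: "\<And>x. 0 \<le> D x"
    using \<mu>.real_RN_deriv[OF assms(2) ac assms(3)] by metis
  have \<nu>: "\<nu> = density \<mu> D"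
    using \<mu>.density_RN_deriv[OF ac assms(3)] density_cong[OF _ _ RN] by simp
  have int: "integrable \<mu> D"
  proof (rule integrableI_nonneg)
    have "(\<integral>\<^sup>+x. ennreal (D x) \<partial>\<mu>) = emeasure \<nu> (space \<mu>)"
      unfolding \<nu> by (simp add: emeasure_density cong: nn_integral_cong)
    then show "(\<integral>\<^sup>+x. ennreal (D x) \<partial>\<mu>) < \<infinity>" by (simp add: \<nu>.emeasure_eq_measure)
  qed (use D0 in auto)
  have "AE x in \<mu>. D x \<in> {..C}"
  proof (rule \<mu>.averaging_theorem[OF int])
    fix A assume A [measurable]: "A \<in> sets \<mu>" and pos: "0 < measure \<mu> A"
    have "ennreal (measure \<nu> A) = (\<integral>\<^sup>+x. ennreal (D x * indicator A x) \<partial>\<mu>)"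
      unfolding \<nu>.emeasure_eq_measure[symmetric] unfolding \<nu>
      by (simp add: emeasure_density ennreal_mult' ennreal_indicator D0)
    also have "\<dots> = ennreal (\<integral>x. D x * indicator A x \<partial>\<mu>)"
      using D0 by (intro nn_integral_eq_integral integrable_real_mult_indicator int) auto
    finally have "measure \<nu> A = set_lebesgue_integral \<mu> A D"
      using D0 by (simp add: set_lebesgue_integral_def mult.commute)
    with dom[OF A] pos show "(1 / measure \<mu> A) *\<^sub>R set_lebesgue_integral \<mu> A D \<in> {..C}"
      by (simp add: divide_simps mult.commute)
  qed simp
  \<comment> \<open>The truncation level is \<open>max C 0\<close> because \<open>C\<close> may be
    negative, while the truncated density has to stay nonnegative everywhere.\<close>
  then have "AE x in \<mu>. ennreal (D x) = ennreal (min (D x) (max C 0))"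
    by eventually_elim (auto simp: min_def max_def)
  then have "\<nu> = density \<mu> (\<lambda>x. min (D x) (max C 0))"
    unfolding \<nu> by (intro density_cong) auto
  moreover have "bounded (range (\<lambda>x. min (D x) (max C 0)))"
    using D0 by (intro boundedI[of _ "max C 0"]) auto
  ultimately show thesis
    using D0 by (intro that[of "\<lambda>x. min (D x) (max C 0)"]) auto
qed

lemma M1D:
  assumes "\<mu> \<in> M1 N R W"
  shows "prob_space \<mu>" "sets \<mu> = sets N" "space \<mu> = space N"
    "\<mu> = distr (density \<mu> (\<lambda>x. ennreal (W x))) N R"
  using assms sets_eq_imp_space_eq[of \<mu> N] by (auto simp: M1_def)

section \<open>Weak invariance, minimality and extreme points in \<open>M1 N R W\<close>\<close>

context weighted_endo
begin

lemma integral_M1: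
  fixes g :: "'b \<Rightarrow> real"
  assumes \<mu>: "\<mu> \<in> M1 N R W" and g [measurable]: "g \<in> borel_measurable N"
  shows "(\<integral>x. g x \<partial>\<mu>) = (\<integral>x. W x * g (R x) \<partial>\<mu>)"
proof -
  note M1D(2,3)[OF \<mu>, measurable_cong, simp]
  have ae: "AE x in \<mu>. 0 \<le> W x" using W_nonneg by (intro AE_I2) simp
  have "(\<integral>x. g x \<partial>\<mu>) = (\<integral>x. g x \<partial>distr (density \<mu> (\<lambda>x. ennreal (W x))) N R)"
    using M1D(4)[OF \<mu>] by simp
  also have "\<dots> = (\<integral>x. W x * g (R x) \<partial>\<mu>)"
    using ae by (simp add: integral_distr integral_real_density)
  finally show ?thesis .
qed

lemma nn_integral_M1:
  assumes \<mu>: "\<mu> \<in> M1 N R W" and g [measurable]: "g \<in> borel_measurable N"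
  shows "(\<integral>\<^sup>+x. g x \<partial>\<mu>) = (\<integral>\<^sup>+x. ennreal (W x) * g (R x) \<partial>\<mu>)"
proof -
  note M1D(2)[OF \<mu>, measurable_cong]
  have "(\<integral>\<^sup>+x. g x \<partial>\<mu>) = (\<integral>\<^sup>+x. g x \<partial>distr (density \<mu> (\<lambda>x. ennreal (W x))) N R)"
    using M1D(4)[OF \<mu>] by simp
  also have "\<dots> = (\<integral>\<^sup>+x. ennreal (W x) * g (R x) \<partial>\<mu>)"
    by (subst nn_integral_distr) (auto simp: nn_integral_density)
  finally show ?thesis .
qed

lemma bounded_mult_compose:
  fixes f g :: "'b \<Rightarrow> real"
  assumes "bounded (f ` space N)" "bounded (g ` space N)"
  shows "bounded ((\<lambda>x. f x * g x) ` space N)" "bounded ((\<lambda>x. f (R x)) ` space N)"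
proof -
  obtain K L where K: "0 < K" "\<And>x. x \<in> space N \<Longrightarrow> \<bar>f x\<bar> \<le> K"
    and L: "\<And>x. x \<in> space N \<Longrightarrow> \<bar>g x\<bar> \<le> L"
    using assms[THEN bounded_imageE] by metis
  show "bounded ((\<lambda>x. f x * g x) ` space N)"
    using K L by (intro boundedI[of _ "K * L"]) (auto simp: abs_mult intro!: mult_mono)
  show "bounded ((\<lambda>x. f (R x)) ` space N)"
    using K measurable_space[OF R_measurable] by (intro boundedI[of _ K]) auto
qed

lemma integrable_M1:
  fixes f :: "'b \<Rightarrow> real"
  assumes "\<mu> \<in> M1 N R W" "f \<in> borel_measurable N" "bounded (f ` space N)"
  shows "integrable \<mu> f"
proof -
  interpret prob_space \<mu> using M1D(1)[OF assms(1)] .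
  note M1D(2,3)[OF assms(1), measurable_cong, simp]
  show ?thesis using assms by (intro integrable_bounded_image) (auto cong: measurable_cong_sets)
qed

text \<open>Both sides of the defining equation of relative ergodicity are conditional expectations,
  of \<open>W f\<close> and of \<open>W (f \<circ> R)\<close>; testing against \<open>R\<^sup>-\<^sup>1(A)\<close> yields the weak form.\<close>

lemma relative_invariance_iff:
  fixes f :: "'b \<Rightarrow> real"
  assumes \<mu>: "\<mu> \<in> M1 N R W" and f [measurable]: "f \<in> borel_measurable N"
    and bd: "bounded (f ` space N)"
  defines "E \<equiv> real_cond_exp \<mu> (vimage_algebra (space N) R N)"
  shows "(AE x in \<mu>. E (\<lambda>y. W y * f y) x = E W x * f (R x)) \<longleftrightarrow>
    (\<forall>A\<in>sets N. (\<integral>x. f x * indicator A x \<partial>\<mu>) = (\<integral>x. W x * f x * indicator A (R x) \<partial>\<mu>))"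
proof -
  define F where "F = vimage_algebra (space N) R N"
  note s = M1D(2,3)[OF \<mu>]
  note s[measurable_cong, simp]
  interpret \<mu>: prob_space \<mu> using M1D(1)[OF \<mu>] .
  have setsF: "sets F = {R -` A \<inter> space N | A. A \<in> sets N}"
    unfolding F_def using measurable_space[OF R_measurable] by (intro sets_vimage_algebra2) auto
  have sub: "subalgebra \<mu> F"
    unfolding subalgebra_def setsF using measurable_sets[OF R_measurable] by (auto simp: F_def)
  interpret sigma_finite_subalgebra \<mu> F
    by (intro finite_measure_subalgebra_is_sigma_finite finite_measure_subalgebra.intro
        finite_measure_subalgebra_axioms.intro \<mu>.finite_measure_axioms sub)
  have RF: "R \<in> measurable F N"
    unfolding F_def using measurable_space[OF R_measurable] by (intro measurable_vimage_algebra1) auto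
  have fR [measurable]: "(\<lambda>x. f (R x)) \<in> borel_measurable F"
    by (rule measurable_compose[OF RF f])
  have I1: "integrable \<mu> (\<lambda>x. W x * f x)" and I2: "integrable \<mu> (\<lambda>x. f (R x) * W x)"
    by (auto intro!: integrable_M1[OF \<mu>] bounded_mult_compose bd W_bounded)
  \<comment> \<open>The factor \<open>f (R x)\<close> is \<open>F\<close>-measurable and can be
    pulled out.\<close>
  have E2: "AE x in \<mu>. real_cond_exp \<mu> F (\<lambda>x. f (R x) * W x) x = f (R x) * real_cond_exp \<mu> F W x"
    by (rule real_cond_exp_mult) (use I2 in auto)
  \<comment> \<open>Invariance of \<open>\<mu>\<close> turns an integral over \<open>A\<close> into
    a weighted one over the preimage of \<open>A\<close>, and such preimages are exactly the sets of
    \<open>F\<close>.\<close>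
  have ind: "(\<integral>x. f x * indicator A x \<partial>\<mu>) = (\<integral>x\<in>R -` A \<inter> space N. f (R x) * W x \<partial>\<mu>)"
    if "A \<in> sets N" for A
    using integral_M1[OF \<mu>, of "\<lambda>x. f x * indicator A x"] that
    by (auto simp: set_lebesgue_integral_def indicator_def intro!: Bochner_Integration.integral_cong)
  have ind': "(\<integral>x. W x * f x * indicator A (R x) \<partial>\<mu>) = (\<integral>x\<in>R -` A \<inter> space N. W x * f x \<partial>\<mu>)" for A
    by (auto simp: set_lebesgue_integral_def indicator_def intro!: Bochner_Integration.integral_cong)
  have "(AE x in \<mu>. E (\<lambda>y. W y * f y) x = E W x * f (R x)) \<longleftrightarrow>
    (AE x in \<mu>. real_cond_exp \<mu> F (\<lambda>y. W y * f y) x = real_cond_exp \<mu> F (\<lambda>x. f (R x) * W x) x)"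
    unfolding E_def F_def[symmetric]
    by (intro eventually_subst, rule eventually_mono[OF E2]) (simp add: mult.commute)
  also have "\<dots> \<longleftrightarrow> (\<forall>B\<in>sets F. (\<integral>x\<in>B. W x * f x \<partial>\<mu>) = (\<integral>x\<in>B. f (R x) * W x \<partial>\<mu>))"
  proof
    assume ae: "AE x in \<mu>. real_cond_exp \<mu> F (\<lambda>y. W y * f y) x = real_cond_exp \<mu> F (\<lambda>x. f (R x) * W x) x"
    show "\<forall>B\<in>sets F. (\<integral>x\<in>B. W x * f x \<partial>\<mu>) = (\<integral>x\<in>B. f (R x) * W x \<partial>\<mu>)"
    proof
      fix B assume B: "B \<in> sets F"
      then have BN: "B \<in> sets N" using sub by (auto simp: subalgebra_def)
      show "(\<integral>x\<in>B. W x * f x \<partial>\<mu>) = (\<integral>x\<in>B. f (R x) * W x \<partial>\<mu>)"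
        unfolding real_cond_exp_intA[OF I1 B] real_cond_exp_intA[OF I2 B]
      proof (intro set_lebesgue_integral_cong_AE)
        show "AE x\<in>B in \<mu>. real_cond_exp \<mu> F (\<lambda>y. W y * f y) x = real_cond_exp \<mu> F (\<lambda>x. f (R x) * W x) x"
          using ae by eventually_elim simp
      qed (use BN in simp_all)
    qed
  next
    assume eq: "\<forall>B\<in>sets F. (\<integral>x\<in>B. W x * f x \<partial>\<mu>) = (\<integral>x\<in>B. f (R x) * W x \<partial>\<mu>)"
    show "AE x in \<mu>. real_cond_exp \<mu> F (\<lambda>y. W y * f y) x = real_cond_exp \<mu> F (\<lambda>x. f (R x) * W x) x"
    proof (rule real_cond_exp_charact)
      fix B assume B: "B \<in> sets F"
      show "(\<integral>x\<in>B. W x * f x \<partial>\<mu>) = (\<integral>x\<in>B. real_cond_exp \<mu> F (\<lambda>x. f (R x) * W x) x \<partial>\<mu>)"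
        unfolding real_cond_exp_intA[OF I2 B, symmetric] using eq B by blast
    qed (use I1 real_cond_exp_int(1)[OF I2] in auto)
  qed
  also have "\<dots> \<longleftrightarrow> (\<forall>A\<in>sets N. (\<integral>x. f x * indicator A x \<partial>\<mu>) = (\<integral>x. W x * f x * indicator A (R x) \<partial>\<mu>))"
  proof -
    have "((\<integral>x\<in>R -` A \<inter> space N. W x * f x \<partial>\<mu>) = (\<integral>x\<in>R -` A \<inter> space N. f (R x) * W x \<partial>\<mu>)) \<longleftrightarrow>
        (\<integral>x. f x * indicator A x \<partial>\<mu>) = (\<integral>x. W x * f x * indicator A (R x) \<partial>\<mu>)"
      if "A \<in> sets N" for A
      unfolding ind[OF that] ind' by (rule eq_commute)
    then show ?thesis unfolding setsF by blast
  qed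
  finally show ?thesis .
qed

text \<open>Since \<open>f\<close> and \<open>W\<close> are bounded and nonnegative, the density
  measure and its weighted push-forward take finite values given by real integrals. Their equality
  is therefore the weak form in \<open>relative_invariance_iff\<close>, and the mean being 1 is the
  normalisation.\<close>

lemma density_in_M1_iff:
  fixes f :: "'b \<Rightarrow> real"
  assumes \<mu>: "\<mu> \<in> M1 N R W" and f [measurable]: "f \<in> borel_measurable N"
    and bd: "bounded (f ` space N)" and nn: "\<And>x. x \<in> space N \<Longrightarrow> 0 \<le> f x"
  shows "density \<mu> f \<in> M1 N R W \<longleftrightarrow> (\<integral>x. f x \<partial>\<mu>) = 1 \<and>
    (\<forall>A\<in>sets N. (\<integral>x. f x * indicator A x \<partial>\<mu>) = (\<integral>x. W x * f x * indicator A (R x) \<partial>\<mu>))"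
proof -
  note s = M1D(2,3)[OF \<mu>]
  note s[measurable_cong, simp]
  interpret \<mu>: prob_space \<mu> using M1D(1)[OF \<mu>] .
  have e1: "emeasure (density \<mu> f) A = ennreal (\<integral>x. f x * indicator A x \<partial>\<mu>)"
    if [measurable]: "A \<in> sets N" for A
  proof -
    have "emeasure (density \<mu> f) A = (\<integral>\<^sup>+x. ennreal (f x * indicator A x) \<partial>\<mu>)"
      by (auto simp: emeasure_density indicator_def intro!: nn_integral_cong)
    also have "\<dots> = ennreal (\<integral>x. f x * indicator A x \<partial>\<mu>)"
      using nn by (intro nn_integral_eq_integral integrable_real_mult_indicator integrable_M1[OF \<mu>] bd) auto
    finally show ?thesis .
  qed
  have e2: "emeasure (distr (density (density \<mu> f) (\<lambda>x. ennreal (W x))) N R) A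
      = ennreal (\<integral>x. W x * f x * indicator A (R x) \<partial>\<mu>)"
    if [measurable]: "A \<in> sets N" for A
  proof -
    have "emeasure (distr (density (density \<mu> f) (\<lambda>x. ennreal (W x))) N R) A
        = (\<integral>\<^sup>+x. ennreal (W x * f x * indicator (R -` A \<inter> space N) x) \<partial>\<mu>)"
      using nn W_nonneg
      by (auto simp: emeasure_distr emeasure_density nn_integral_density indicator_def ennreal_mult
          mult.commute intro!: nn_integral_cong)
    also have "\<dots> = ennreal (\<integral>x. W x * f x * indicator (R -` A \<inter> space N) x \<partial>\<mu>)"
      using nn W_nonneg
      by (intro nn_integral_eq_integral integrable_real_mult_indicator integrable_M1[OF \<mu>] bd
          bounded_mult_compose W_bounded) auto
    also have "(\<integral>x. W x * f x * indicator (R -` A \<inter> space N) x \<partial>\<mu>) = (\<integral>x. W x * f x * indicator A (R x) \<partial>\<mu>)"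
      by (intro Bochner_Integration.integral_cong) (auto simp: indicator_def)
    finally show ?thesis .
  qed
  have "prob_space (density \<mu> f) \<longleftrightarrow> (\<integral>x. f x \<partial>\<mu>) = 1"
  proof -
    have "emeasure (density \<mu> f) (space N) = ennreal (\<integral>x. f x \<partial>\<mu>)"
      unfolding e1[OF sets.top] by (intro arg_cong[of _ _ ennreal] Bochner_Integration.integral_cong) auto
    then show ?thesis
      by (auto intro!: prob_spaceI dest: prob_space.emeasure_space_1)
  qed
  moreover have "density \<mu> f = distr (density (density \<mu> f) (\<lambda>x. ennreal (W x))) N R \<longleftrightarrow>
    (\<forall>A\<in>sets N. (\<integral>x. f x * indicator A x \<partial>\<mu>) = (\<integral>x. W x * f x * indicator A (R x) \<partial>\<mu>))"
  proof -
    have "density \<mu> f = distr (density (density \<mu> f) (\<lambda>x. ennreal (W x))) N R \<longleftrightarrow>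
      (\<forall>A\<in>sets N. emeasure (density \<mu> f) A
        = emeasure (distr (density (density \<mu> f) (\<lambda>x. ennreal (W x))) N R) A)"
      by (auto intro!: measure_eqI)
    also have "\<dots> \<longleftrightarrow> (\<forall>A\<in>sets N. (\<integral>x. f x * indicator A x \<partial>\<mu>) = (\<integral>x. W x * f x * indicator A (R x) \<partial>\<mu>))"
    proof (intro ball_cong refl)
      fix A assume A: "A \<in> sets N"
      have "0 \<le> (\<integral>x. f x * indicator A x \<partial>\<mu>)" "0 \<le> (\<integral>x. W x * f x * indicator A (R x) \<partial>\<mu>)"
        using nn W_nonneg by (intro Bochner_Integration.integral_nonneg; simp)+
      with A show "emeasure (density \<mu> f) A
          = emeasure (distr (density (density \<mu> f) (\<lambda>x. ennreal (W x))) N R) A \<longleftrightarrow>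
        (\<integral>x. f x * indicator A x \<partial>\<mu>) = (\<integral>x. W x * f x * indicator A (R x) \<partial>\<mu>)"
        by (simp add: e1 e2)
    qed
    finally show ?thesis .
  qed
  ultimately show ?thesis by (auto simp: M1_def)
qed

text \<open>A link between extremality and relative ergodicity. It compares \<open>\<mu>\<close>
  with one measure at a time, up to a factor, which makes it easy to carry between the solenoid and
  the base.\<close>

definition minimal_in_M1 :: "'b measure \<Rightarrow> bool" where
  "minimal_in_M1 \<mu> \<longleftrightarrow> (\<forall>\<nu>\<in>M1 N R W. \<forall>C.
     (\<forall>A\<in>sets N. measure \<nu> A \<le> C * measure \<mu> A) \<longrightarrow> \<nu> = \<mu>)"

text \<open>A dominated \<open>\<nu>\<close> has a bounded density. Membership of
  \<open>\<nu>\<close> in the set makes this density relatively invariant, hence constant, and total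
  mass 1 makes the constant 1.\<close>

lemma relatively_ergodic_imp_minimal:
  assumes \<mu>: "\<mu> \<in> M1 N R W" and erg: "relatively_ergodic N R W \<mu>"
  shows "minimal_in_M1 \<mu>"
  unfolding minimal_in_M1_def
proof (intro ballI allI impI)
  fix \<nu> C assume \<nu>: "\<nu> \<in> M1 N R W" and dom: "\<forall>A\<in>sets N. measure \<nu> A \<le> C * measure \<mu> A"
  note s = M1D(2,3)[OF \<mu>]
  note s[measurable_cong, simp]
  interpret \<mu>: prob_space \<mu> using M1D(1)[OF \<mu>] .
  interpret \<nu>: prob_space \<nu> using M1D(1)[OF \<nu>] .
  obtain f :: "'b \<Rightarrow> real" where f: "f \<in> borel_measurable \<mu>" and nn: "\<And>x. 0 \<le> f x"
    and bd: "bounded (range f)" and eq: "\<nu> = density \<mu> f"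
    using dominated_density[OF \<mu>.finite_measure_axioms \<nu>.finite_measure_axioms, of C] dom M1D(2)[OF \<nu>]
    by (metis s(1))
  have [measurable]: "f \<in> borel_measurable N" using f by (simp cong: measurable_cong_sets)
  have bd': "bounded (f ` space N)" by (rule bounded_subset[OF bd]) auto
  have f1: "(\<integral>x. f x \<partial>\<mu>) = 1"
    and inv: "\<forall>A\<in>sets N. (\<integral>x. f x * indicator A x \<partial>\<mu>) = (\<integral>x. W x * f x * indicator A (R x) \<partial>\<mu>)"
    using density_in_M1_iff[OF \<mu> _ bd' nn] \<nu> eq by auto
  obtain c where c: "AE x in \<mu>. f x = c"
    using erg inv nn bd' relative_invariance_iff[OF \<mu> _ bd'] unfolding relatively_ergodic_def Let_def
    by force
  then have "(\<integral>x. f x \<partial>\<mu>) = (\<integral>x. c \<partial>\<mu>)" by (intro integral_cong_AE) auto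
  then have "c = 1" using f1 \<mu>.prob_space by simp
  with c have "density \<mu> f = density \<mu> (\<lambda>_. 1)" by (intro density_cong) auto
  then show "\<nu> = \<mu>" by (simp add: eq density_1)
qed

text \<open>Each component of a proper convex combination is bounded by \<open>\<mu>\<close> divided
  by its weight.\<close>

lemma minimal_imp_extreme:
  assumes \<mu>: "\<mu> \<in> M1 N R W" and "minimal_in_M1 \<mu>"
  shows "extreme_measure \<mu> (M1 N R W)"
  unfolding extreme_measure_def
proof (intro conjI ballI allI impI \<mu>)
  fix \<nu>\<^sub>1 \<nu>\<^sub>2 t assume \<nu>: "\<nu>\<^sub>1 \<in> M1 N R W" "\<nu>\<^sub>2 \<in> M1 N R W"
    and t: "0 < t \<and> t < 1 \<and> (\<forall>A\<in>sets \<mu>. measure \<mu> A = (1 - t) * measure \<nu>\<^sub>1 A + t * measure \<nu>\<^sub>2 A)"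
  have "measure \<nu>\<^sub>1 A \<le> 1 / (1 - t) * measure \<mu> A" "measure \<nu>\<^sub>2 A \<le> 1 / t * measure \<mu> A"
    if "A \<in> sets N" for A
    using t that M1D(2)[OF \<mu>] by (auto simp: divide_simps mult.commute)
  then have "\<nu>\<^sub>1 = \<mu>" "\<nu>\<^sub>2 = \<mu>"
    using assms(2) \<nu> unfolding minimal_in_M1_def by blast+
  then show "\<nu>\<^sub>1 = \<nu>\<^sub>2" by simp
qed

text \<open>If \<open>f\<close> is invariant with mean \<open>m\<close>, then \<open>\<mu>\<close> is the midpoint of the measures with densities
  \<open>1 \<plusminus> (f - m) / K\<close>.\<close>

lemma extreme_imp_relatively_ergodic:
  assumes \<mu>: "\<mu> \<in> M1 N R W" and ext: "extreme_measure \<mu> (M1 N R W)"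
  shows "relatively_ergodic N R W \<mu>"
  unfolding relatively_ergodic_def Let_def
proof (intro conjI allI impI \<mu>)
  note s = M1D(2,3)[OF \<mu>]
  note s[measurable_cong, simp]
  interpret \<mu>: prob_space \<mu> using M1D(1)[OF \<mu>] .
  fix f :: "'b \<Rightarrow> real"
  assume f: "f \<in> borel_measurable N \<and> (\<forall>x\<in>space N. 0 \<le> f x) \<and> bounded (f ` space N) \<and>
    (AE x in \<mu>. real_cond_exp \<mu> (vimage_algebra (space N) R N) (\<lambda>y. W y * f y) x
      = real_cond_exp \<mu> (vimage_algebra (space N) R N) W x * f (R x))"
  then have [measurable]: "f \<in> borel_measurable N" and bd: "bounded (f ` space N)" by auto
  have inv: "(\<integral>x. f x * indicator A x \<partial>\<mu>) = (\<integral>x. W x * f x * indicator A (R x) \<partial>\<mu>)"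
    if "A \<in> sets N" for A
    using relative_invariance_iff[OF \<mu> _ bd] f that by auto
  define m where "m = (\<integral>x. f x \<partial>\<mu>)"
  obtain K0 where K0: "0 < K0" "\<And>x. x \<in> space N \<Longrightarrow> \<bar>f x\<bar> \<le> K0"
    using bd bounded_imageE by blast
  define K where "K = K0 + \<bar>m\<bar>"
  have K: "0 < K" "\<And>x. x \<in> space N \<Longrightarrow> \<bar>f x - m\<bar> \<le> K"
    using K0 unfolding K_def by (auto intro: order_trans[OF abs_triangle_ineq4])
  \<comment> \<open>Only \<open>e = 1\<close> and \<open>e = - 1\<close> are used. The choice of
    \<open>K\<close> keeps both densities between 0 and 2, and subtracting \<open>m\<close> gives
    them mean 1.\<close>
  define g where "g = (\<lambda>e x. 1 + e * (f x - m) / K)"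
  have int_f: "integrable \<mu> f" by (intro integrable_M1[OF \<mu>] bd) auto
  have g_meas [measurable]: "g e \<in> borel_measurable N" for e unfolding g_def by measurable
  have g_nn: "0 \<le> g e x" and g_le: "\<bar>g e x\<bar> \<le> 2" if "x \<in> space N" "\<bar>e\<bar> = 1" for e x
  proof -
    have "\<bar>e * (f x - m) / K\<bar> \<le> 1" using K that by (simp add: abs_mult)
    then show "0 \<le> g e x" "\<bar>g e x\<bar> \<le> 2" unfolding g_def by linarith+
  qed
  have g_bd: "bounded (g e ` space N)" if "\<bar>e\<bar> = 1" for e
    using g_le that by (intro boundedI[of _ 2]) auto
  have in_M1: "density \<mu> (g e) \<in> M1 N R W" if e: "\<bar>e\<bar> = 1" for e
  proof (subst density_in_M1_iff[OF \<mu> g_meas g_bd[OF e] g_nn[OF _ e]])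
    \<comment> \<open>Linearity reduces the invariance of \<open>g e\<close> to that of the constant
      1, which is the invariance of \<open>\<mu>\<close>, and that of \<open>f\<close>.\<close>
    have split: "(\<integral>x. g e x * h x \<partial>\<mu>) = (1 - e * m / K) * (\<integral>x. h x \<partial>\<mu>) + e / K * (\<integral>x. f x * h x \<partial>\<mu>)"
      if [measurable]: "h \<in> borel_measurable N" and hb: "bounded (h ` space N)" for h
    proof -
      have "integrable \<mu> h" "integrable \<mu> (\<lambda>x. f x * h x)"
        by (auto intro!: integrable_M1[OF \<mu>] bounded_mult_compose hb bd)
      moreover have "g e x * h x = (1 - e * m / K) * h x + e / K * (f x * h x)" for x
        using K(1) by (simp add: g_def field_simps)
      ultimately show ?thesis by simp
    qed
    have "(\<integral>x. g e x * indicator A x \<partial>\<mu>) = (\<integral>x. W x * g e x * indicator A (R x) \<partial>\<mu>)"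
      if [measurable]: "A \<in> sets N" for A
    proof -
      have b: "bounded ((indicator A :: 'b \<Rightarrow> real) ` space N)"
        by (intro boundedI[of _ 1]) (auto simp: indicator_def)
      have "(\<integral>x. indicator A x \<partial>\<mu>) = (\<integral>x. W x * indicator A (R x) \<partial>\<mu>)"
        by (rule integral_M1[OF \<mu>]) simp
      then have "(\<integral>x. g e x * indicator A x \<partial>\<mu>) = (\<integral>x. g e x * (W x * indicator A (R x)) \<partial>\<mu>)"
        using inv[OF that] split[of "indicator A"] split[of "\<lambda>x. W x * indicator A (R x)"] b
        by (simp add: bounded_mult_compose W_bounded ac_simps)
      then show ?thesis by (simp add: ac_simps)
    qed
    moreover have "(\<integral>x. g e x \<partial>\<mu>) = 1"
      using split[of "\<lambda>_. 1"] K(1) \<mu>.prob_space by (simp add: m_def[symmetric] image_constant_conv)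
    ultimately show "(\<integral>x. g e x \<partial>\<mu>) = 1 \<and> (\<forall>A\<in>sets N. (\<integral>x. g e x * indicator A x \<partial>\<mu>)
        = (\<integral>x. W x * g e x * indicator A (R x) \<partial>\<mu>))" by blast
  qed
  have meas: "measure (density \<mu> (g e)) A = (\<integral>x. g e x * indicator A x \<partial>\<mu>)"
    if "A \<in> sets N" "\<bar>e\<bar> = 1" for A e
  proof -
    have "measure (density \<mu> (g e)) A = enn2real (\<integral>\<^sup>+x. ennreal (g e x * indicator A x) \<partial>\<mu>)"
      using that by (auto simp: measure_def emeasure_density indicator_def
          intro!: nn_integral_cong arg_cong[of _ _ enn2real])
    also have "\<dots> = (\<integral>x. g e x * indicator A x \<partial>\<mu>)"
      using that g_nn by (intro integral_eq_nn_integral[symmetric]) auto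
    finally show ?thesis .
  qed
  have "density \<mu> (g 1) = density \<mu> (g (- 1))"
  proof -
    have "measure \<mu> A = (1 - 1/2) * measure (density \<mu> (g 1)) A + 1/2 * measure (density \<mu> (g (- 1))) A"
      if A: "A \<in> sets \<mu>" for A
    proof -
      have AN [measurable]: "A \<in> sets N" using A by simp
      have I: "integrable \<mu> (\<lambda>x. g e x * indicator A x)" if "\<bar>e\<bar> = 1" for e
        using integrable_M1[OF \<mu> g_meas g_bd[OF that]] by (intro integrable_real_mult_indicator) auto
      have "(\<integral>x. g 1 x * indicator A x \<partial>\<mu>) + (\<integral>x. g (- 1) x * indicator A x \<partial>\<mu>)
        = (\<integral>x. g 1 x * indicator A x + g (- 1) x * indicator A x \<partial>\<mu>)"
        by (rule Bochner_Integration.integral_add[symmetric]) (auto intro: I)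
      also have "\<dots> = (\<integral>x. 2 * indicator A x \<partial>\<mu>)"
        by (intro Bochner_Integration.integral_cong) (auto simp: g_def indicator_def diff_divide_distrib)
      also have "\<dots> = 2 * measure \<mu> A" using AN by (simp add: Int_absorb2 sets.sets_into_space)
      finally show ?thesis using AN by (simp add: meas)
    qed
    then show ?thesis
      using ext[unfolded extreme_measure_def, THEN conjunct2, rule_format,
          of "density \<mu> (g 1)" "density \<mu> (g (- 1))" "1/2"] in_M1 by auto
  qed
  then have "AE x in \<mu>. ennreal (g 1 x) = ennreal (g (- 1) x)"
    by (intro \<mu>.density_unique) auto
  then have "AE x in \<mu>. f x = m"
  proof (rule AE_mp, intro AE_I2 impI)
    fix x assume x: "x \<in> space \<mu>" and "ennreal (g 1 x) = ennreal (g (- 1) x)"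
    then have "g 1 x = g (- 1) x" using g_nn[of x 1] g_nn[of x "- 1"] by simp
    then show "f x = m" using K(1) by (simp add: g_def field_simps)
  qed
  then show "\<exists>c. AE x in \<mu>. f x = c" by blast
qed

lemma extreme_iff_minimal:
  "\<mu> \<in> M1 N R W \<Longrightarrow> extreme_measure \<mu> (M1 N R W) \<longleftrightarrow> minimal_in_M1 \<mu>"
  using extreme_imp_relatively_ergodic relatively_ergodic_imp_minimal minimal_imp_extreme by blast

lemma extreme_iff_relatively_ergodic:
  "\<mu> \<in> M1 N R W \<Longrightarrow> extreme_measure \<mu> (M1 N R W) \<longleftrightarrow> relatively_ergodic N R W \<mu>"
  using extreme_imp_relatively_ergodic relatively_ergodic_imp_minimal minimal_imp_extreme by blast

end

text \<open>A measurable left inverse \<open>T\<close> makes the preimage algebra of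
  \<open>R\<close> all of \<open>sets N\<close>, so the defining equation reads
  \<open>W x * f x = W x * f (R x)\<close>. Cancelling \<open>W\<close> where it is positive gives
  invariance almost everywhere for the weighted measure \<open>\<sigma>\<close>. The null sets of
  \<open>\<mu>\<close> and \<open>\<sigma>\<close> may differ; constancy passes back to
  \<open>\<mu>\<close> because \<open>\<mu>\<close> is the image of \<open>\<sigma>\<close> under
  \<open>R\<close>.\<close>

lemma (in weighted_endo) relatively_ergodic_iff_ergodic:
  assumes \<mu>: "\<mu> \<in> M1 N R W" and T [measurable]: "T \<in> measurable N N"
    and TR: "\<And>x. x \<in> space N \<Longrightarrow> T (R x) = x"
  shows "relatively_ergodic N R W \<mu> \<longleftrightarrow> ergodic (density \<mu> (\<lambda>x. ennreal (W x))) R"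
proof -
  define F where "F = vimage_algebra (space N) R N"
  define \<sigma> where "\<sigma> = density \<mu> (\<lambda>x. ennreal (W x))"
  note s = M1D(2,3)[OF \<mu>]
  note s[measurable_cong, simp]
  have s\<sigma> [measurable_cong, simp]: "sets \<sigma> = sets N" and sp\<sigma> [simp]: "space \<sigma> = space N"
    by (simp_all add: \<sigma>_def)
  interpret \<mu>: prob_space \<mu> using M1D(1)[OF \<mu>] .
  have setsF: "sets F = sets N"
  proof
    show "sets F \<subseteq> sets N"
      unfolding F_def by (rule sets_image_in_sets) auto
    show "sets N \<subseteq> sets F"
    proof
      fix A assume A: "A \<in> sets N"
      have "A = R -` (T -` A \<inter> space N) \<inter> space N"
        using sets.sets_into_space[OF A] measurable_space[OF R_measurable] TR by auto
      then show "A \<in> sets F"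
        unfolding F_def using measurable_sets[OF T A] by (metis in_vimage_algebra)
    qed
  qed
  interpret sigma_finite_subalgebra \<mu> F
    by (intro finite_measure_subalgebra_is_sigma_finite finite_measure_subalgebra.intro
        finite_measure_subalgebra_axioms.intro \<mu>.finite_measure_axioms)
      (simp add: subalgebra_def setsF, simp add: F_def)
  have E: "AE x in \<mu>. real_cond_exp \<mu> F g x = g x"
    if "g \<in> borel_measurable N" "bounded (g ` space N)" for g :: "'b \<Rightarrow> real"
    using that by (intro real_cond_exp_F_meas integrable_M1[OF \<mu>]) (auto simp: setsF cong: measurable_cong_sets)
  have iff: "(AE x in \<mu>. real_cond_exp \<mu> F (\<lambda>y. W y * f y) x = real_cond_exp \<mu> F W x * f (R x)) \<longleftrightarrow>
      (AE x in \<sigma>. f x = f (R x))"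
    if [measurable]: "f \<in> borel_measurable N" and "bounded (f ` space N)" for f :: "'b \<Rightarrow> real"
  proof -
    have "AE x in \<mu>. real_cond_exp \<mu> F (\<lambda>y. W y * f y) x = W x * f x"
      using that by (intro E bounded_mult_compose W_bounded) auto
    moreover have "AE x in \<mu>. real_cond_exp \<mu> F W x = W x"
      by (intro E W_bounded) auto
    moreover have "AE x in \<mu>. 0 \<le> W x" using W_nonneg by (intro AE_I2) simp
    ultimately have "AE x in \<mu>. (real_cond_exp \<mu> F (\<lambda>y. W y * f y) x = real_cond_exp \<mu> F W x * f (R x)) =
        (0 < ennreal (W x) \<longrightarrow> f x = f (R x))"
      by eventually_elim (auto simp: less_le)
    then show ?thesis unfolding \<sigma>_def by (simp add: AE_density eventually_subst)
  qed
  have AE_\<sigma>: "AE x in \<sigma>. P x" if "AE x in \<mu>. P x" for P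
    using that unfolding \<sigma>_def by (auto simp: AE_density elim: eventually_mono)
  show ?thesis
    unfolding \<sigma>_def[symmetric]
  proof
    assume erg: "relatively_ergodic N R W \<mu>"
    show "ergodic \<sigma> R"
      unfolding ergodic_def
    proof (intro allI impI)
      fix f :: "'b \<Rightarrow> real"
      assume f: "f \<in> borel_measurable \<sigma> \<and> bounded (f ` space \<sigma>) \<and> (AE x in \<sigma>. f x = f (R x))"
      then have [measurable]: "f \<in> borel_measurable N" by (simp cong: measurable_cong_sets)
      \<comment> \<open>Relative ergodicity only tests nonnegative functions, so it is applied to
        \<open>f + K\<close>.\<close>
      obtain K where K: "\<And>x. x \<in> space N \<Longrightarrow> \<bar>f x\<bar> \<le> K"
        using f bounded_imageE[of f "space N"] by auto
      have nn: "0 \<le> f x + K" "\<bar>f x + K\<bar> \<le> 2 * K" if "x \<in> space N" for x using K[OF that] by auto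
      have bd: "bounded ((\<lambda>x. f x + K) ` space N)"
        using nn by (intro boundedI[of _ "2 * K"]) auto
      have "AE x in \<mu>. real_cond_exp \<mu> F (\<lambda>y. W y * (f y + K)) x = real_cond_exp \<mu> F W x * (f (R x) + K)"
        using f by (subst iff[OF _ bd]) auto
      then obtain c where "AE x in \<mu>. f x + K = c"
        using erg bd nn(1) unfolding relatively_ergodic_def Let_def F_def[symmetric]
        by (auto dest!: spec[of _ "\<lambda>x. f x + K"])
      then have "AE x in \<mu>. f x = c - K" by eventually_elim simp
      then show "\<exists>c. AE x in \<sigma>. f x = c" using AE_\<sigma> by blast
    qed
  next
    assume erg: "ergodic \<sigma> R"
    show "relatively_ergodic N R W \<mu>"
      unfolding relatively_ergodic_def Let_def F_def[symmetric]
    proof (intro conjI \<mu> allI impI)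
      fix f :: "'b \<Rightarrow> real"
      assume f: "f \<in> borel_measurable N \<and> (\<forall>x\<in>space N. 0 \<le> f x) \<and> bounded (f ` space N) \<and>
        (AE x in \<mu>. real_cond_exp \<mu> F (\<lambda>y. W y * f y) x = real_cond_exp \<mu> F W x * f (R x))"
      then have fm [measurable]: "f \<in> borel_measurable N" by simp
      have inv: "AE x in \<sigma>. f x = f (R x)" using f iff[OF fm] by blast
      moreover have "f \<in> borel_measurable \<sigma>" by measurable
      moreover have "bounded (f ` space \<sigma>)" using f by simp
      ultimately obtain c where "AE x in \<sigma>. f x = c"
        using erg unfolding ergodic_def by blast
      \<comment> \<open>Invariance replaces \<open>f\<close> by \<open>f\<close> after
        \<open>R\<close>, so that the conclusion can be read on the image measure, which is
        \<open>\<mu>\<close>.\<close>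
      with inv have "AE x in \<sigma>. f (R x) = c" by eventually_elim simp
      then have "AE x in distr \<sigma> N R. f x = c" by (subst AE_distr_iff) auto
      then show "\<exists>c. AE x in \<mu>. f x = c"
        unfolding \<sigma>_def by (intro exI[of _ c], subst M1D(4)[OF \<mu>])
    qed
  qed
qed

subsection \<open>Dominated additive set functions\<close>

text \<open>Domination supplies the continuity at the empty set that Caratheodory's theorem asks
  for: if the sets \<open>A i\<close> decrease to the empty set, then \<open>l (A i)\<close> is
  squeezed between 0 and \<open>C * measure \<mu> (A i)\<close>, which tends to 0.\<close>

lemma dominated_additive_extension:
  fixes l :: "'b set \<Rightarrow> real"
  assumes "finite_measure \<mu>" and alg: "algebra (space \<mu>) G"
    and gen: "sets \<mu> = sigma_sets (space \<mu>) G"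
    and nonneg: "\<And>A. A \<in> G \<Longrightarrow> 0 \<le> l A" and dom: "\<And>A. A \<in> G \<Longrightarrow> l A \<le> C * measure \<mu> A"
    and add: "\<And>A B. A \<in> G \<Longrightarrow> B \<in> G \<Longrightarrow> A \<inter> B = {} \<Longrightarrow> l (A \<union> B) = l A + l B"
  shows "\<exists>\<nu>. finite_measure \<nu> \<and> sets \<nu> = sets \<mu> \<and> (\<forall>A\<in>G. measure \<nu> A = l A)"
proof -
  interpret \<mu>: finite_measure \<mu> by fact
  interpret G: algebra "space \<mu>" G by fact
  have sub: "G \<subseteq> sets \<mu>" unfolding gen by auto
  have "l {} = 0" using add[of "{}" "{}"] by simp
  have "\<exists>m :: 'b set \<Rightarrow> ennreal. (\<forall>s\<in>G. m s = ennreal (l s)) \<and> measure_space (space \<mu>) (sigma_sets (space \<mu>) G) m"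
  proof (rule G.caratheodory_empty_continuous)
    show "positive G (\<lambda>A. ennreal (l A))" using \<open>l {} = 0\<close> by (simp add: positive_def)
    show "additive G (\<lambda>A. ennreal (l A))"
      using add nonneg by (simp add: additive_def ennreal_plus[symmetric] del: ennreal_plus)
    fix A :: "nat \<Rightarrow> 'b set" assume A: "range A \<subseteq> G" "decseq A" "(\<Inter>i. A i) = {}"
    have "(\<lambda>i. C * measure \<mu> (A i)) \<longlonglongrightarrow> C * measure \<mu> (\<Inter>i. A i)"
      using A sub by (intro tendsto_mult_left \<mu>.finite_Lim_measure_decseq) auto
    then have "(\<lambda>i. C * measure \<mu> (A i)) \<longlonglongrightarrow> 0" using A(3) by simp
    then have "(\<lambda>i. l (A i)) \<longlonglongrightarrow> 0"
      by (rule tendsto_sandwich[rotated 2, OF tendsto_const])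
        (use A(1) nonneg dom in \<open>auto intro!: always_eventually\<close>)
    then show "(\<lambda>i. ennreal (l (A i))) \<longlonglongrightarrow> 0"
      using tendsto_ennrealI by fastforce
  qed simp
  then obtain m where m: "\<And>A. A \<in> G \<Longrightarrow> m A = ennreal (l A)" and ms: "measure_space (space \<mu>) (sets \<mu>) m"
    unfolding gen by blast
  define \<nu> where "\<nu> = measure_of (space \<mu>) (sets \<mu>) m"
  have sets: "sets \<nu> = sets \<mu>" unfolding \<nu>_def by simp
  have em: "emeasure \<nu> A = m A" if "A \<in> sets \<mu>" for A
    using that ms unfolding \<nu>_def measure_space_def by (intro emeasure_measure_of_sigma) auto
  have "finite_measure \<nu>"
  proof (rule finite_measureI)
    show "emeasure \<nu> (space \<nu>) \<noteq> \<infinity>"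
      using sets_eq_imp_space_eq[OF sets] em[of "space \<mu>"] m[of "space \<mu>"] by simp
  qed
  moreover have "measure \<nu> A = l A" if "A \<in> G" for A
    using that sub em[of A] m nonneg by (auto simp: measure_def)
  ultimately show ?thesis using sets by blast
qed

text \<open>Extending \<open>C \<mu> - l\<close> as well turns the bound on the algebra into one on the \<open>\<sigma>\<close>-algebra:
  the two extensions add up to \<open>C \<mu>\<close> by uniqueness.\<close>

lemma dominated_additive_extension_le:
  fixes l :: "'b set \<Rightarrow> real"
  assumes "finite_measure \<mu>" and alg: "algebra (space \<mu>) G"
    and gen: "sets \<mu> = sigma_sets (space \<mu>) G"
    and nonneg: "\<And>A. A \<in> G \<Longrightarrow> 0 \<le> l A" and dom: "\<And>A. A \<in> G \<Longrightarrow> l A \<le> C * measure \<mu> A"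
    and add: "\<And>A B. A \<in> G \<Longrightarrow> B \<in> G \<Longrightarrow> A \<inter> B = {} \<Longrightarrow> l (A \<union> B) = l A + l B"
  obtains \<nu> where "finite_measure \<nu>" "sets \<nu> = sets \<mu>" "\<And>A. A \<in> G \<Longrightarrow> measure \<nu> A = l A"
    "\<And>A. A \<in> sets \<mu> \<Longrightarrow> measure \<nu> A \<le> C * measure \<mu> A"
proof -
  interpret \<mu>: finite_measure \<mu> by fact
  interpret G: algebra "space \<mu>" G by fact
  have sub: "G \<subseteq> sets \<mu>" unfolding gen by auto
  obtain \<nu> where \<nu>: "finite_measure \<nu>" "sets \<nu> = sets \<mu>" "\<And>A. A \<in> G \<Longrightarrow> measure \<nu> A = l A"
    using dominated_additive_extension[OF assms] by blast
  have "\<exists>\<kappa>. finite_measure \<kappa> \<and> sets \<kappa> = sets \<mu> \<and> (\<forall>A\<in>G. measure \<kappa> A = C * measure \<mu> A - l A)"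
  proof (rule dominated_additive_extension[OF assms(1-3), where C = C])
    fix A B assume "A \<in> G" "B \<in> G" "A \<inter> B = {}"
    then show "C * measure \<mu> (A \<union> B) - l (A \<union> B) = C * measure \<mu> A - l A + (C * measure \<mu> B - l B)"
      using sub add by (subst \<mu>.finite_measure_Union) (auto simp: algebra_simps)
  qed (use nonneg dom in auto)
  then obtain \<kappa> where \<kappa>: "finite_measure \<kappa>" "sets \<kappa> = sets \<mu>"
      "\<And>A. A \<in> G \<Longrightarrow> measure \<kappa> A = C * measure \<mu> A - l A"
    by blast
  interpret \<nu>: finite_measure \<nu> by fact
  interpret \<kappa>: finite_measure \<kappa> by fact
  note sp = sets_eq_imp_space_eq[OF \<nu>(2)] sets_eq_imp_space_eq[OF \<kappa>(2)]
  have "measure \<nu> A + measure \<kappa> A = C * measure \<mu> A" if "A \<in> sets \<mu>" for A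
    using G.Int_stable G.space_closed that unfolding gen
  proof (induction rule: sigma_sets_induct_disjoint)
    case (basic A)
    then show ?case using \<nu>(3) \<kappa>(3) by simp
  next
    case (compl A)
    have A: "A \<in> sets \<mu>" using compl unfolding gen by simp
    have "measure \<nu> (space \<mu>) + measure \<kappa> (space \<mu>) = C * measure \<mu> (space \<mu>)"
      using \<nu>(3) \<kappa>(3) by simp
    moreover have "measure \<nu> (space \<mu> - A) = measure \<nu> (space \<mu>) - measure \<nu> A"
      "measure \<kappa> (space \<mu> - A) = measure \<kappa> (space \<mu>) - measure \<kappa> A"
      "measure \<mu> (space \<mu> - A) = measure \<mu> (space \<mu>) - measure \<mu> A"
      using A \<nu>.finite_measure_compl[of A] \<kappa>.finite_measure_compl[of A]
        \<mu>.finite_measure_compl[of A] \<nu>(2) \<kappa>(2) sp by simp_all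
    ultimately show ?case
      using compl(2) by (simp add: right_diff_distrib)
  next
    case (union A)
    have A: "range A \<subseteq> sets \<mu>" using union unfolding gen by simp
    have "(\<lambda>i. measure \<nu> (A i) + measure \<kappa> (A i)) sums (measure \<nu> (\<Union>i. A i) + measure \<kappa> (\<Union>i. A i))"
      using A union(1) \<nu>(2) \<kappa>(2)
      by (intro sums_add \<nu>.finite_measure_UNION \<kappa>.finite_measure_UNION) auto
    moreover have "(\<lambda>i. C * measure \<mu> (A i)) sums (C * measure \<mu> (\<Union>i. A i))"
      using A union(1) by (intro sums_mult \<mu>.finite_measure_UNION)
    ultimately show ?case using union(3) sums_unique2 by simp
  qed simp
  then have "measure \<nu> A \<le> C * measure \<mu> A" if "A \<in> sets \<mu>" for A
    using that by (metis le_add_same_cancel1 measure_nonneg)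
  with \<nu> show thesis by (intro that)
qed

subsection \<open>Measures on the solenoid\<close>

lemma coord_compose: "g \<in> measurable M L \<Longrightarrow> (\<lambda>x. g (x n)) \<in> measurable (solenoid_algebra M r) L"
  by (rule measurable_compose[OF measurable_coord])

text \<open>One coordinate suffices to get an algebra, since on the solenoid each coordinate
  determines all earlier ones.\<close>

definition cylinders :: "'a measure \<Rightarrow> ('a \<Rightarrow> 'a) \<Rightarrow> (nat \<Rightarrow> 'a) set set" where
  "cylinders M r = {(\<lambda>x. x n) -` A \<inter> solenoid M r | n A. A \<in> sets M}"

section \<open>The algebra of cylinders and the push-forward form of \<open>Mqi1\<close>\<close>

context finite_to_one_endo
begin

lemma coord_funpow:
  assumes "x \<in> solenoid M r"
  shows "(r ^^ k) (x (n + k)) = x n"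
  using assms by (induction k) (auto simp: solenoid_def funpow_swap1)

lemma measurable_funpow: "r ^^ k \<in> measurable M M"
  by (induction k) (auto intro: measurable_compose[OF _ r_measurable] simp: id_def comp_def)

lemma cylinder_shift:
  "(\<lambda>x. x n) -` A \<inter> solenoid M r = (\<lambda>x. x (n + k)) -` ((r ^^ k) -` A \<inter> space M) \<inter> solenoid M r"
proof -
  have "x (n + k) \<in> space M" if "x \<in> solenoid M r" for x
    using that by (auto simp: solenoid_def)
  then show ?thesis using coord_funpow by auto
qed

lemma sets_solenoid_algebra:
  "sets (solenoid_algebra M r) = sigma_sets (solenoid M r) (cylinders M r)"
  unfolding solenoid_algebra_def cylinders_def by (rule sets_measure_of) auto

text \<open>Cylinders of levels \<open>n\<^sub>1\<close> and \<open>n\<^sub>2\<close> are both moved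
  to level \<open>n\<^sub>1 + n\<^sub>2\<close>, so the two levels need not be compared. Set
  operations on cylinders then become operations in \<open>sets M\<close>.\<close>

lemma cylinder_common:
  assumes "B\<^sub>1 \<in> cylinders M r" "B\<^sub>2 \<in> cylinders M r"
  obtains n A\<^sub>1 A\<^sub>2 where "A\<^sub>1 \<in> sets M" "A\<^sub>2 \<in> sets M"
    "B\<^sub>1 = (\<lambda>x. x n) -` A\<^sub>1 \<inter> solenoid M r" "B\<^sub>2 = (\<lambda>x. x n) -` A\<^sub>2 \<inter> solenoid M r"
proof -
  obtain n\<^sub>1 A\<^sub>1 n\<^sub>2 A\<^sub>2 where A: "A\<^sub>1 \<in> sets M" "A\<^sub>2 \<in> sets M"
    and B: "B\<^sub>1 = (\<lambda>x. x n\<^sub>1) -` A\<^sub>1 \<inter> solenoid M r" "B\<^sub>2 = (\<lambda>x. x n\<^sub>2) -` A\<^sub>2 \<inter> solenoid M r"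
    using assms by (auto simp: cylinders_def)
  have "(r ^^ n\<^sub>2) -` A\<^sub>1 \<inter> space M \<in> sets M" "(r ^^ n\<^sub>1) -` A\<^sub>2 \<inter> space M \<in> sets M"
    using A measurable_sets[OF measurable_funpow] by blast+
  moreover have "B\<^sub>1 = (\<lambda>x. x (n\<^sub>1 + n\<^sub>2)) -` ((r ^^ n\<^sub>2) -` A\<^sub>1 \<inter> space M) \<inter> solenoid M r"
    unfolding B by (rule cylinder_shift)
  moreover have "B\<^sub>2 = (\<lambda>x. x (n\<^sub>1 + n\<^sub>2)) -` ((r ^^ n\<^sub>1) -` A\<^sub>2 \<inter> space M) \<inter> solenoid M r"
    unfolding B by (subst add.commute) (rule cylinder_shift)
  ultimately show thesis by (rule that)
qed

lemma algebra_cylinders: "algebra (solenoid M r) (cylinders M r)"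
  unfolding algebra_iff_Int
proof (intro conjI ballI)
  show "cylinders M r \<subseteq> Pow (solenoid M r)" by (auto simp: cylinders_def)
  show "{} \<in> cylinders M r" unfolding cylinders_def by auto
  fix B assume B: "B \<in> cylinders M r"
  then obtain n A where A: "A \<in> sets M" and "B = (\<lambda>x. x n) -` A \<inter> solenoid M r"
    by (auto simp: cylinders_def)
  then have "solenoid M r - B = (\<lambda>x. x n) -` (space M - A) \<inter> solenoid M r"
    by (auto simp: solenoid_def)
  then show "solenoid M r - B \<in> cylinders M r"
    using A unfolding cylinders_def by blast
  fix B' assume "B' \<in> cylinders M r"
  with B obtain m C D where C: "C \<in> sets M" "D \<in> sets M"
    "B = (\<lambda>x. x m) -` C \<inter> solenoid M r" "B' = (\<lambda>x. x m) -` D \<inter> solenoid M r"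
    by (rule cylinder_common)
  then have "B \<inter> B' = (\<lambda>x. x m) -` (C \<inter> D) \<inter> solenoid M r" by auto
  with C show "B \<inter> B' \<in> cylinders M r"
    unfolding cylinders_def by blast
qed

text \<open>Positive levels are convenient because \<open>rhat r x (Suc n) = x n\<close>: pulling
  such a cylinder back along \<open>rhat r\<close> just lowers its level.\<close>

lemma cylinders_Suc:
  assumes "B \<in> cylinders M r"
  obtains n A where "A \<in> sets M" "B = (\<lambda>x. x (Suc n)) -` A \<inter> solenoid M r"
proof -
  obtain n A where A: "A \<in> sets M" and B: "B = (\<lambda>x. x n) -` A \<inter> solenoid M r"
    using assms by (auto simp: cylinders_def)
  have "(r ^^ 1) -` A \<inter> space M \<in> sets M"
    using A measurable_sets[OF measurable_funpow] by blast
  with B cylinder_shift[of n A 1] show thesis by (intro that) auto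
qed

lemma measure_eqI_cylinders:
  assumes "finite_measure \<mu>" "sets \<mu> = sets (solenoid_algebra M r)" "sets \<nu> = sets (solenoid_algebra M r)"
    and eq: "\<And>n A. A \<in> sets M \<Longrightarrow> emeasure \<mu> ((\<lambda>x. x (Suc n)) -` A \<inter> solenoid M r)
      = emeasure \<nu> ((\<lambda>x. x (Suc n)) -` A \<inter> solenoid M r)"
  shows "\<mu> = \<nu>"
proof (rule measure_eqI_generator_eq)
  interpret algebra "solenoid M r" "cylinders M r" by (rule algebra_cylinders)
  interpret finite_measure \<mu> by fact
  show "Int_stable (cylinders M r)" by (rule Int_stable)
  show "cylinders M r \<subseteq> Pow (solenoid M r)" by (rule space_closed)
  show "range (\<lambda>_::nat. solenoid M r) \<subseteq> cylinders M r" by auto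
  show "emeasure \<mu> B = emeasure \<nu> B" if "B \<in> cylinders M r" for B
    using that by (rule cylinders_Suc) (use eq in blast)
  show "sets \<mu> = sigma_sets (solenoid M r) (cylinders M r)" "sets \<nu> = sigma_sets (solenoid M r) (cylinders M r)"
    using assms(2,3) sets_solenoid_algebra by simp_all
  show "(\<Union>i::nat. solenoid M r) = solenoid M r" by simp
  show "emeasure \<mu> (solenoid M r) \<noteq> \<infinity>" by simp
qed

text \<open>The measure \<open>comp_measure \<mu> (rhat r)\<close> is the push-forward of
  \<open>\<mu>\<close> under the shift \<open>T\<close>, the inverse of \<open>rhat r\<close>. The
  Radon-Nikodym condition says that this push-forward has density \<open>V (x 0)\<close>; pushing
  forward once more under \<open>rhat r\<close> gives the invariance equation, and \<open>T\<close>
  undoes this.\<close>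

lemma Mqi1_eq_M1:
  assumes V: "V \<in> borel_measurable M"
  shows "Mqi1 M r V = M1 (solenoid_algebra M r) (rhat r) (\<lambda>x. V (x 0))"
proof -
  define S where "S = solenoid_algebra M r"
  define T :: "(nat \<Rightarrow> 'a) \<Rightarrow> nat \<Rightarrow> 'a" where "T = (\<lambda>x n. x (Suc n))"
  have T: "T \<in> measurable S S" unfolding T_def S_def by (rule measurable_tail)
  have R: "rhat r \<in> measurable S S" unfolding S_def by (rule measurable_rhat)
  have "(absolutely_continuous \<mu> (comp_measure \<mu> (rhat r)) \<and>
       (AE x in \<mu>. RN_deriv \<mu> (comp_measure \<mu> (rhat r)) x = ennreal (V (x 0)))) \<longleftrightarrow>
      \<mu> = distr (density \<mu> (\<lambda>x. ennreal (V (x 0)))) S (rhat r)" (is "?L \<longleftrightarrow> ?R")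
    if "prob_space \<mu>" and s: "sets \<mu> = sets S" for \<mu>
  proof -
    interpret prob_space \<mu> by fact
    note s[measurable_cong]
    have sp: "space \<mu> = solenoid M r"
      using sets_eq_imp_space_eq[OF s] by (simp add: S_def space_solenoid_algebra)
    have W [measurable]: "(\<lambda>x. V (x 0)) \<in> borel_measurable \<mu>"
      using measurable_compose[OF measurable_coord V] s by (simp add: S_def cong: measurable_cong_sets)
    have comp: "comp_measure \<mu> (rhat r) = distr \<mu> S T"
      using comp_rhat_eq_distr[of \<mu>] s by (simp add: S_def T_def)
    have TR: "distr (distr \<mu> S T) S (rhat r) = \<mu>"
    proof -
      have "distr (distr \<mu> S T) S (rhat r) = distr \<mu> S (\<lambda>x. rhat r (T x))"
        using T R by (subst distr_distr) (auto simp: comp_def cong: measurable_cong_sets[OF s refl])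
      also have "\<dots> = distr \<mu> S (\<lambda>x. x)"
        by (intro distr_cong) (simp_all add: sp T_def rhat_tail)
      finally show ?thesis using s by (simp add: distr_id2)
    qed
    have RT: "distr (distr (density \<mu> (\<lambda>x. ennreal (V (x 0)))) S (rhat r)) S T
        = density \<mu> (\<lambda>x. ennreal (V (x 0)))" (is "distr (distr ?D S _) S T = _")
    proof -
      have "distr (distr ?D S (rhat r)) S T = distr ?D S (\<lambda>x. T (rhat r x))"
        using T R by (subst distr_distr) (auto simp: comp_def cong: measurable_cong_sets)
      also have "\<dots> = ?D"
        using s by (simp add: T_def tail_rhat distr_id2)
      finally show ?thesis .
    qed
    show ?thesis
    proof
      assume L: ?L
      then have "density \<mu> (\<lambda>x. ennreal (V (x 0))) = density \<mu> (RN_deriv \<mu> (comp_measure \<mu> (rhat r)))"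
        by (intro density_cong) (auto elim: eventually_mono)
      also have "\<dots> = distr \<mu> S T"
        unfolding comp using L s by (intro density_RN_deriv) (simp_all add: comp)
      finally show ?R using TR by simp
    next
      assume ?R
      then have D: "density \<mu> (\<lambda>x. ennreal (V (x 0))) = comp_measure \<mu> (rhat r)"
        using RT comp by metis
      show ?L
      proof
        show "absolutely_continuous \<mu> (comp_measure \<mu> (rhat r))"
          unfolding D[symmetric] by (rule absolutely_continuousI_density) measurable
        have "AE x in \<mu>. ennreal (V (x 0)) = RN_deriv \<mu> (comp_measure \<mu> (rhat r)) x"
          by (rule RN_deriv_unique[OF _ D]) measurable
        then show "AE x in \<mu>. RN_deriv \<mu> (comp_measure \<mu> (rhat r)) x = ennreal (V (x 0))"
          by eventually_elim simp
      qed
    qed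
  qed
  then show ?thesis unfolding Mqi1_def M1_def S_def by blast
qed

end

section \<open>Transfer between the base and the solenoid\<close>

locale weighted_finite_to_one_endo = finite_to_one_endo M r + base: weighted_endo M r V
  for M :: "'a measure" and r V

sublocale weighted_finite_to_one_endo \<subseteq> solenoid: weighted_endo "solenoid_algebra M r" "rhat r" "\<lambda>x. V (x 0)"
proof
  show "(\<lambda>x. V (x 0)) \<in> borel_measurable (solenoid_algebra M r)"
    by (rule measurable_compose[OF measurable_coord base.W_measurable])
  have x0: "x 0 \<in> space M" if "x \<in> space (solenoid_algebra M r)" for x
    using that by (simp add: space_solenoid_algebra solenoid_def)
  then show "0 \<le> V (x 0)" if "x \<in> space (solenoid_algebra M r)" for x
    using that base.W_nonneg by blast
  show "bounded ((\<lambda>x. V (x 0)) ` space (solenoid_algebra M r))"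
    by (rule bounded_subset[OF base.W_bounded]) (use x0 in auto)
qed (rule measurable_rhat)

context weighted_finite_to_one_endo
begin

abbreviation Msol :: "(nat \<Rightarrow> 'a) measure set" where
  "Msol \<equiv> M1 (solenoid_algebra M r) (rhat r) (\<lambda>x. V (x 0))"

abbreviation marginal :: "(nat \<Rightarrow> 'a) measure \<Rightarrow> 'a measure" where
  "marginal \<mu> \<equiv> distr \<mu> M (\<lambda>x. x 0)"


lemma nn_integral_marginal:
  assumes "sets \<mu> = sets (solenoid_algebra M r)" "g \<in> borel_measurable M"
  shows "(\<integral>\<^sup>+y. g y \<partial>distr \<mu> M (\<lambda>x. x n)) = (\<integral>\<^sup>+x. g (x n) \<partial>\<mu>)"
proof (rule nn_integral_distr)
  show "(\<lambda>x. x n) \<in> measurable \<mu> M"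
    unfolding measurable_cong_sets[OF assms(1) refl] by (rule measurable_coord)
qed (simp add: assms(2))

text \<open>The coordinate 0 intertwines the two maps, \<open>rhat r x 0 = r (x 0)\<close>, and the
  weight on the solenoid depends on that coordinate only.\<close>

lemma marginal_in_M1:
  assumes \<mu>: "\<mu> \<in> Msol"
  shows "marginal \<mu> \<in> M1 M r V"
proof -
  note s = M1D(2,3)[OF \<mu>]
  note s(1)[measurable_cong]
  interpret \<mu>: prob_space \<mu> using M1D(1)[OF \<mu>] .
  have c [measurable]: "(\<lambda>x. x 0) \<in> measurable \<mu> M"
    unfolding measurable_cong_sets[OF s(1) refl] by (rule measurable_coord)
  have "prob_space (marginal \<mu>)" by (rule \<mu>.prob_space_distr) (rule c)
  moreover have "marginal \<mu> = distr (density (marginal \<mu>) (\<lambda>x. ennreal (V x))) M r"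
  proof (rule measure_eqI)
    fix A assume "A \<in> sets (marginal \<mu>)"
    then have A [measurable]: "A \<in> sets M" by simp
    note [measurable] = coord_compose[OF borel_measurable_indicator[OF A]]
    have "emeasure (marginal \<mu>) A = (\<integral>\<^sup>+x. indicator A (x 0) \<partial>\<mu>)"
      by (subst nn_integral_marginal[OF s(1), symmetric]) simp_all
    also have "\<dots> = (\<integral>\<^sup>+x. ennreal (V (x 0)) * indicator A (r (x 0)) \<partial>\<mu>)"
      by (subst solenoid.nn_integral_M1[OF \<mu>]) (measurable, simp add: rhat_def)
    also have "\<dots> = (\<integral>\<^sup>+y. ennreal (V y) * indicator A (r y) \<partial>marginal \<mu>)"
      using measurable_compose[OF r_measurable borel_measurable_indicator[OF A]]
      by (intro nn_integral_marginal[OF s(1), symmetric] borel_measurable_times_ennreal) simp_all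
    also have "\<dots> = emeasure (distr (density (marginal \<mu>) (\<lambda>x. ennreal (V x))) M r) A"
      by (auto simp: emeasure_distr emeasure_density indicator_def intro!: nn_integral_cong)
    finally show "emeasure (marginal \<mu>) A = \<dots>" .
  qed simp
  ultimately show ?thesis by (simp add: M1_def)
qed

text \<open>Invariance under \<open>rhat r\<close> lowers both indices by one at the cost of a
  factor \<open>V (x 0)\<close>. Written as \<open>V ((r ^^ n) (x n))\<close>, this factor is
  absorbed into the function of coordinate \<open>n\<close>, which is what makes inductions on
  \<open>n\<close> work.\<close>

lemma nn_integral_coord_Suc:
  assumes \<mu>: "\<mu> \<in> Msol" and g [measurable]: "g \<in> borel_measurable M" "h \<in> borel_measurable M"
  shows "(\<integral>\<^sup>+x. g (x (Suc n)) * h (x (Suc m)) \<partial>\<mu>) = (\<integral>\<^sup>+x. ennreal (V ((r ^^ n) (x n))) * g (x n) * h (x m) \<partial>\<mu>)"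
proof -
  note [measurable] = coord_compose[OF g(1)] coord_compose[OF g(2)]
  have "(\<integral>\<^sup>+x. g (x (Suc n)) * h (x (Suc m)) \<partial>\<mu>) = (\<integral>\<^sup>+x. ennreal (V (x 0)) * (g (x n) * h (x m)) \<partial>\<mu>)"
    by (subst solenoid.nn_integral_M1[OF \<mu>]) (measurable, simp add: rhat_def)
  also have "\<dots> = (\<integral>\<^sup>+x. ennreal (V ((r ^^ n) (x n))) * g (x n) * h (x m) \<partial>\<mu>)"
    using coord_funpow[where n = 0] M1D(3)[OF \<mu>]
    by (intro nn_integral_cong) (auto simp: space_solenoid_algebra mult.assoc)
  finally show ?thesis .
qed

text \<open>By \<open>nn_integral_coord_Suc\<close> with \<open>h = 1\<close>, integrals of
  functions of coordinate \<open>Suc n\<close> reduce to integrals of functions of coordinate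
  \<open>n\<close>, and so finally to the marginal.\<close>

lemma marginal_determines:
  assumes \<mu>: "\<mu> \<in> Msol" and \<nu>: "\<nu> \<in> Msol" and eq: "marginal \<mu> = marginal \<nu>"
  shows "\<mu> = \<nu>"
proof -
  note s = M1D(2)[OF \<mu>] M1D(2)[OF \<nu>]
  note [measurable] = measurable_funpow
  have int: "(\<integral>\<^sup>+x. g (x n) \<partial>\<mu>) = (\<integral>\<^sup>+x. g (x n) \<partial>\<nu>)" if "g \<in> borel_measurable M" for g n
    using that
  proof (induction n arbitrary: g)
    case 0
    then show ?case using eq nn_integral_marginal[OF s(1) 0, of 0] nn_integral_marginal[OF s(2) 0, of 0] by simp
  next
    case (Suc n)
    note Suc.prems[measurable]
    have "(\<integral>\<^sup>+x. ennreal (V ((r ^^ n) (x n))) * g (x n) \<partial>\<mu>) = (\<integral>\<^sup>+x. ennreal (V ((r ^^ n) (x n))) * g (x n) \<partial>\<nu>)"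
      by (rule Suc.IH) measurable
    then show ?case
      using nn_integral_coord_Suc[OF \<mu> Suc.prems, of "\<lambda>_. 1" n n] nn_integral_coord_Suc[OF \<nu> Suc.prems, of "\<lambda>_. 1" n n]
      by simp
  qed
  show ?thesis
  proof (rule measure_eqI_cylinders[OF _ s])
    show "finite_measure \<mu>" using M1D(1)[OF \<mu>] by (simp add: prob_space_def)
    fix n A assume A: "A \<in> sets M"
    have "emeasure \<kappa> ((\<lambda>x. x (Suc n)) -` A \<inter> solenoid M r) = (\<integral>\<^sup>+x. indicator A (x (Suc n)) \<partial>\<kappa>)"
      if "sets \<kappa> = sets (solenoid_algebra M r)" for \<kappa>
    proof -
      have "(\<lambda>x. x (Suc n)) \<in> measurable \<kappa> M"
        unfolding measurable_cong_sets[OF that refl] by (rule measurable_coord)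
      then show ?thesis
        using nn_integral_marginal[OF that, of "indicator A" "Suc n"] A sets_eq_imp_space_eq[OF that]
        by (simp add: emeasure_distr space_solenoid_algebra)
    qed
    then show "emeasure \<mu> ((\<lambda>x. x (Suc n)) -` A \<inter> solenoid M r)
        = emeasure \<nu> ((\<lambda>x. x (Suc n)) -` A \<inter> solenoid M r)"
      using s int[of "indicator A"] A by simp
  qed
qed

text \<open>The weak form of the martingale property of \<open>f (x n)\<close>. For one step at
  level 0 it is the invariance of the density measure on the base;
  \<open>nn_integral_coord_Suc\<close> carries it to every level, and then the steps are
  chained.\<close>

lemma density_coord_martingale:
  assumes \<mu>: "\<mu> \<in> Msol" and f [measurable]: "f \<in> borel_measurable M"
    and \<nu>: "density (marginal \<mu>) f \<in> M1 M r V" and g: "g \<in> borel_measurable M"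
  shows "(\<integral>\<^sup>+x. g (x n) * f (x (n + k)) \<partial>\<mu>) = (\<integral>\<^sup>+x. g (x n) * f (x n) \<partial>\<mu>)"
proof -
  note s = M1D(2)[OF \<mu>] and [measurable] = measurable_funpow
  have step: "(\<integral>\<^sup>+x. g (x n) * f (x (Suc n)) \<partial>\<mu>) = (\<integral>\<^sup>+x. g (x n) * f (x n) \<partial>\<mu>)"
    if "g \<in> borel_measurable M" for g n
    using that
  proof (induction n arbitrary: g)
    case 0
    note 0[measurable] and [measurable] = coord_compose[OF 0] coord_compose[OF f]
    have "(\<integral>\<^sup>+x. g (x 0) * f (x (Suc 0)) \<partial>\<mu>) = (\<integral>\<^sup>+x. f (x 0) * (ennreal (V (x 0)) * g (r (x 0))) \<partial>\<mu>)"
      by (subst solenoid.nn_integral_M1[OF \<mu>]) (measurable, simp add: rhat_def ac_simps)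
    also have "\<dots> = (\<integral>\<^sup>+y. ennreal (V y) * g (r y) \<partial>density (marginal \<mu>) f)"
      by (subst nn_integral_density) (auto simp: nn_integral_marginal[OF s])
    also have "\<dots> = (\<integral>\<^sup>+y. g y \<partial>density (marginal \<mu>) f)"
      by (rule base.nn_integral_M1[OF \<nu>, symmetric]) measurable
    also have "\<dots> = (\<integral>\<^sup>+x. g (x 0) * f (x 0) \<partial>\<mu>)"
      by (subst nn_integral_density) (auto simp: nn_integral_marginal[OF s] mult.commute)
    finally show ?case .
  next
    case (Suc n)
    note Suc.prems[measurable]
    show ?case
      unfolding nn_integral_coord_Suc[OF \<mu> Suc.prems f]
      by (rule Suc.IH) measurable
  qed
  show ?thesis
  proof (induction k)
    case (Suc k)
    have [measurable]: "(\<lambda>y. g ((r ^^ k) y)) \<in> borel_measurable M"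
      by (rule measurable_compose[OF measurable_funpow g])
    \<comment> \<open>The test function is viewed at level \<open>n + k\<close>, where the one-step
      identity applies.\<close>
    have gk: "g (x n) = g ((r ^^ k) (x (n + k)))" if "x \<in> space \<mu>" for x
      using that M1D(3)[OF \<mu>] by (simp add: coord_funpow space_solenoid_algebra)
    have "(\<integral>\<^sup>+x. g (x n) * f (x (n + Suc k)) \<partial>\<mu>)
        = (\<integral>\<^sup>+x. g ((r ^^ k) (x (n + k))) * f (x (Suc (n + k))) \<partial>\<mu>)"
      by (intro nn_integral_cong) (simp add: gk)
    also have "\<dots> = (\<integral>\<^sup>+x. g ((r ^^ k) (x (n + k))) * f (x (n + k)) \<partial>\<mu>)"
      by (rule step) measurable
    also have "\<dots> = (\<integral>\<^sup>+x. g (x n) * f (x (n + k)) \<partial>\<mu>)"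
      by (intro nn_integral_cong) (simp add: gk)
    finally show ?case using Suc by simp
  qed simp
qed

lemma emeasure_cylinder:
  assumes s: "sets \<kappa> = sets (solenoid_algebra M r)" and A: "A \<in> sets M"
  shows "emeasure \<kappa> ((\<lambda>x. x n) -` A \<inter> solenoid M r) = emeasure (distr \<kappa> M (\<lambda>x. x n)) A"
proof -
  have "(\<lambda>x. x n) \<in> measurable \<kappa> M"
    unfolding measurable_cong_sets[OF s refl] by (rule measurable_coord)
  then show ?thesis
    using A sets_eq_imp_space_eq[OF s] by (simp add: emeasure_distr space_solenoid_algebra)
qed

text \<open>No pointwise limit of \<open>f (x m)\<close> is taken: the measures \<open>F m\<close>
  stabilise on each cylinder, and the bound \<open>K\<close>, uniform in \<open>m\<close>, lets
  their limit extend and survives the extension.\<close>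

lemma lift_dominated:
  assumes \<mu>: "\<mu> \<in> Msol" and \<nu>: "\<nu> \<in> M1 M r V"
    and dom: "\<And>A. A \<in> sets M \<Longrightarrow> measure \<nu> A \<le> C * measure (marginal \<mu>) A"
  obtains \<nu>' K where "\<nu>' \<in> Msol" "marginal \<nu>' = \<nu>"
    "\<And>B. B \<in> sets (solenoid_algebra M r) \<Longrightarrow> measure \<nu>' B \<le> K * measure \<mu> B"
proof -
  let ?S = "solenoid_algebra M r"
  let ?cyl = "\<lambda>n A. (\<lambda>x. x n) -` A \<inter> solenoid M r"
  note s = M1D(2)[OF \<mu>] and sp = M1D(3)[OF \<mu>, unfolded space_solenoid_algebra]
  note s[measurable_cong]
  interpret \<mu>: prob_space \<mu> using M1D(1)[OF \<mu>] .
  interpret \<nu>: prob_space \<nu> using M1D(1)[OF \<nu>] .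
  interpret \<mu>\<^sub>0: prob_space "marginal \<mu>" using M1D(1)[OF marginal_in_M1[OF \<mu>]] .
  obtain f :: "'a \<Rightarrow> real" where "f \<in> borel_measurable (marginal \<mu>)" and nn: "\<And>x. 0 \<le> f x"
    and bd: "bounded (range f)" and \<nu>f: "\<nu> = density (marginal \<mu>) f"
    using dominated_density[OF \<mu>\<^sub>0.finite_measure_axioms \<nu>.finite_measure_axioms, of C] dom M1D(2)[OF \<nu>]
    by (metis sets_distr)
  then have f [measurable]: "(\<lambda>y. ennreal (f y)) \<in> borel_measurable M" by simp
  obtain K where K: "0 < K" "\<And>x. f x \<le> K"
    using bounded_imageE[OF bd] by (metis UNIV_I abs_le_D1)
  note [measurable] = coord_compose[OF f]
  define F where "F m = density \<mu> (\<lambda>x. ennreal (f (x m)))" for m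
  have sF: "sets (F m) = sets ?S" for m by (simp add: F_def s)
  have F_le: "emeasure (F m) B \<le> ennreal K * emeasure \<mu> B" if B: "B \<in> sets ?S" for m B
  proof -
    have "emeasure (F m) B \<le> (\<integral>\<^sup>+x. ennreal K * indicator B x \<partial>\<mu>)"
      unfolding F_def using B s K(2)
      by (subst emeasure_density) (auto intro!: nn_integral_mono mult_right_mono ennreal_leI)
    then show ?thesis using B s by (simp add: nn_integral_cmult_indicator)
  qed
  have finF: "finite_measure (F m)" for m
  proof (rule finite_measureI)
    have "ennreal K * emeasure \<mu> (space \<mu>) \<noteq> \<infinity>" by (simp add: \<mu>.emeasure_space_1)
    then show "emeasure (F m) (space (F m)) \<noteq> \<infinity>"
      using F_le[of "space ?S" m] sets_eq_imp_space_eq[OF sF] M1D(3)[OF \<mu>]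
      by (auto simp: top_unique)
  qed
  have F_le': "measure (F m) B \<le> K * measure \<mu> B" if "B \<in> sets ?S" for m B
  proof -
    interpret F: finite_measure "F m" by (rule finF)
    have "ennreal (measure (F m) B) \<le> ennreal (K * measure \<mu> B)"
      using F_le[OF that, of m] K(1)
      by (simp add: F.emeasure_eq_measure \<mu>.emeasure_eq_measure ennreal_mult)
    then show ?thesis using K(1) by simp
  qed
  have int_F: "(\<integral>\<^sup>+y. g y \<partial>distr (F m) M (\<lambda>x. x n)) = (\<integral>\<^sup>+x. g (x n) * ennreal (f (x m)) \<partial>\<mu>)"
    if g: "g \<in> borel_measurable M" for g m n
  proof -
    note [measurable] = coord_compose[OF g]
    show ?thesis
      unfolding nn_integral_marginal[OF sF g] unfolding F_def
      by (subst nn_integral_density) (measurable, simp add: mult.commute)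
  qed
  have em_F: "emeasure (F m) (?cyl n A) = (\<integral>\<^sup>+x. indicator A (x n) * ennreal (f (x m)) \<partial>\<mu>)"
    if "A \<in> sets M" for A m n
    using int_F[of "indicator A" m n] that by (simp add: emeasure_cylinder[OF sF])
  have stable: "measure (F (n + k)) (?cyl n A) = measure (F n) (?cyl n A)" if "A \<in> sets M" for n k A
    using density_coord_martingale[OF \<mu> f \<nu>[unfolded \<nu>f], of "indicator A" n k] that
    by (simp add: measure_def em_F)
  \<comment> \<open>Using \<open>lim\<close> avoids choosing a representation of a cylinder. On a
    cylinder of level \<open>n\<close> the sequence is constant from \<open>m = n\<close>
    on.\<close>
  define l where "l B = lim (\<lambda>m. measure (F m) B)" for B
  have l_cyl: "l (?cyl n A) = measure (F n) (?cyl n A)" if A: "A \<in> sets M" for n A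
  proof -
    have "measure (F m) (?cyl n A) = measure (F n) (?cyl n A)" if "n \<le> m" for m
      using stable[OF A, of n "m - n"] that by simp
    then have "(\<lambda>m. measure (F m) (?cyl n A)) \<longlonglongrightarrow> measure (F n) (?cyl n A)"
      by (intro tendsto_eventually eventually_sequentiallyI[of n])
    then show ?thesis unfolding l_def by (rule limI)
  qed
  have cyl_sets: "?cyl n A \<in> sets ?S" if "A \<in> sets M" for n A
    using measurable_sets[OF measurable_coord that] by (simp add: space_solenoid_algebra)
  have cyl_in: "?cyl n A \<in> cylinders M r" if "A \<in> sets M" for n A
    using that unfolding cylinders_def by blast
  have cyl: "l B \<le> K * measure \<mu> B" "0 \<le> l B" if "B \<in> cylinders M r" for B
    using that l_cyl F_le' cyl_sets unfolding cylinders_def by auto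
  have add: "l (B \<union> B') = l B + l B'" if B: "B \<in> cylinders M r" "B' \<in> cylinders M r" "B \<inter> B' = {}" for B B'
  proof -
    obtain n A A' where A: "A \<in> sets M" "A' \<in> sets M" and eq: "B = ?cyl n A" "B' = ?cyl n A'"
      using cylinder_common[OF B(1,2)] .
    interpret F: finite_measure "F n" by (rule finF)
    have "B \<union> B' = ?cyl n (A \<union> A')" using eq by auto
    then have "l (B \<union> B') = measure (F n) (B \<union> B')"
      using l_cyl[OF sets.Un[OF A], of n] by metis
    also have "\<dots> = measure (F n) B + measure (F n) B'"
      using B(3) A eq cyl_sets sF by (intro F.finite_measure_Union) auto
    also have "\<dots> = l B + l B'" using l_cyl A eq by simp
    finally show ?thesis .
  qed
  obtain \<nu>' where fin': "finite_measure \<nu>'" and s': "sets \<nu>' = sets \<mu>"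
    and \<nu>'_l: "\<And>B. B \<in> cylinders M r \<Longrightarrow> measure \<nu>' B = l B"
    and \<nu>'_le: "\<And>B. B \<in> sets \<mu> \<Longrightarrow> measure \<nu>' B \<le> K * measure \<mu> B"
    by (rule dominated_additive_extension_le[OF \<mu>.finite_measure_axioms, of "cylinders M r" l K])
      (use algebra_cylinders sp s sets_solenoid_algebra cyl add in auto)
  interpret \<nu>': finite_measure \<nu>' by fact
  have sS': "sets \<nu>' = sets ?S" using s s' by simp
  have em': "emeasure \<nu>' (?cyl n A) = emeasure (F n) (?cyl n A)" if A: "A \<in> sets M" for n A
    using \<nu>'_l[OF cyl_in[OF A]] l_cyl[OF A]
    by (simp add: \<nu>'.emeasure_eq_measure finite_measure.emeasure_eq_measure[OF finF])
  have distr': "distr \<nu>' M (\<lambda>x. x n) = distr (F n) M (\<lambda>x. x n)" for n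
    using em' by (intro measure_eqI) (auto simp: emeasure_cylinder[OF sS'] emeasure_cylinder[OF sF])
  \<comment> \<open>On functions of coordinate \<open>n\<close>, the lifted measure integrates like
    \<open>F n\<close>. The density moves with the level, so \<open>F n\<close> can be exchanged for
    another level later.\<close>
  have int': "(\<integral>\<^sup>+x. g (x n) \<partial>\<nu>') = (\<integral>\<^sup>+x. g (x n) * ennreal (f (x n)) \<partial>\<mu>)"
    if g: "g \<in> borel_measurable M" for g n
    using nn_integral_marginal[OF sS' g, of n] int_F[OF g, of n n] by (simp add: distr')
  have marg: "marginal \<nu>' = \<nu>"
  proof (rule measure_eqI)
    fix A assume "A \<in> sets (marginal \<nu>')"
    then have A: "A \<in> sets M" by simp
    have "emeasure (marginal \<nu>') A = (\<integral>\<^sup>+x. ennreal (f (x 0)) * indicator A (x 0) \<partial>\<mu>)"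
      using int_F[of "indicator A" 0 0] A by (simp add: distr' mult.commute)
    also have "\<dots> = emeasure \<nu> A"
      unfolding \<nu>f using A nn_integral_marginal[OF s, of "\<lambda>y. ennreal (f y) * indicator A y" 0]
      by (simp add: emeasure_density)
    finally show "emeasure (marginal \<nu>') A = emeasure \<nu> A" .
  qed (simp add: M1D(2)[OF \<nu>])
  have "prob_space \<nu>'"
  proof (rule prob_spaceI)
    have "emeasure \<nu>' (?cyl 0 (space M)) = emeasure \<nu> (space M)"
      using emeasure_cylinder[OF sS', of "space M" 0] marg by simp
    moreover have "?cyl 0 (space M) = space \<nu>'"
      using sets_eq_imp_space_eq[OF sS'] by (auto simp: space_solenoid_algebra solenoid_def)
    ultimately show "emeasure \<nu>' (space \<nu>') = 1"
      using \<nu>.emeasure_space_1 M1D(3)[OF \<nu>] by simp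
  qed
  moreover have "\<nu>' = distr (density \<nu>' (\<lambda>x. ennreal (V (x 0)))) ?S (rhat r)"
  proof (rule measure_eqI_cylinders[OF fin' sS'])
    fix n A assume A: "A \<in> sets M"
    let ?V = "\<lambda>y. ennreal (V ((r ^^ n) y)) * indicator A y"
    have V [measurable]: "?V \<in> borel_measurable M"
      using A measurable_compose[OF measurable_funpow base.W_measurable]
      by (intro borel_measurable_times_ennreal) auto
    note s'S [measurable_cong] = sS'
    have ind [measurable]: "(\<lambda>x. indicator A (x (Suc n)) :: ennreal) \<in> borel_measurable ?S"
      using A by (intro coord_compose) auto
    have "emeasure \<nu>' (?cyl (Suc n) A) = (\<integral>\<^sup>+x. indicator A (x (Suc n)) * ennreal (f (x (Suc n))) \<partial>\<mu>)"
      using em' em_F A by simp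
    \<comment> \<open>Lowering the level also turns the density at level \<open>Suc n\<close> into
      the one at level \<open>n\<close>, which \<open>int'\<close> absorbs into
      \<open>\<nu>'\<close> again. The remaining factor in \<open>?V\<close> is the weight
      \<open>V (x 0)\<close> expressed through coordinate \<open>n\<close>.\<close>
    also have "\<dots> = (\<integral>\<^sup>+x. ?V (x n) * ennreal (f (x n)) \<partial>\<mu>)"
      using A by (intro nn_integral_coord_Suc[OF \<mu> _ f]) auto
    also have "\<dots> = (\<integral>\<^sup>+x. ?V (x n) \<partial>\<nu>')" by (rule int'[OF V, symmetric])
    also have "\<dots> = (\<integral>\<^sup>+x. ennreal (V (x 0)) * indicator A (rhat r x (Suc n)) \<partial>\<nu>')"
      using coord_funpow[where n = 0] sets_eq_imp_space_eq[OF sS']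
      by (intro nn_integral_cong) (simp add: space_solenoid_algebra rhat_def)
    also have "\<dots> = (\<integral>\<^sup>+x. indicator A (rhat r x (Suc n)) \<partial>density \<nu>' (\<lambda>x. ennreal (V (x 0))))"
      using measurable_compose[OF measurable_rhat ind]
      by (subst nn_integral_density) (simp_all cong: measurable_cong_sets add: measurable_cong_sets[OF sS' refl])
    also have "\<dots> = (\<integral>\<^sup>+x. indicator A (x (Suc n)) \<partial>distr (density \<nu>' (\<lambda>x. ennreal (V (x 0)))) ?S (rhat r))"
      using measurable_rhat by (subst nn_integral_distr) (simp_all add: measurable_cong_sets[OF sS' refl] ind)
    also have "\<dots> = emeasure (distr (density \<nu>' (\<lambda>x. ennreal (V (x 0)))) ?S (rhat r)) (?cyl (Suc n) A)"
      using A nn_integral_marginal[of "distr (density \<nu>' (\<lambda>x. ennreal (V (x 0)))) ?S (rhat r)" "indicator A" "Suc n"]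
      by (subst emeasure_cylinder) simp_all
    finally show "emeasure \<nu>' (?cyl (Suc n) A)
        = emeasure (distr (density \<nu>' (\<lambda>x. ennreal (V (x 0)))) ?S (rhat r)) (?cyl (Suc n) A)" .
  qed simp
  ultimately have "\<nu>' \<in> Msol" by (simp add: M1_def sS')
  with marg \<nu>'_le show thesis by (intro that) (auto simp: s)
qed

text \<open>A measure on the base dominated by the marginal lifts to one dominated by
  \<open>\<mu>\<close>, which must be \<open>\<mu>\<close>. Conversely, domination passes to
  marginals, and equal marginals force equal measures.\<close>

lemma minimal_marginal_iff:
  assumes \<mu>: "\<mu> \<in> Msol"
  shows "solenoid.minimal_in_M1 \<mu> \<longleftrightarrow> base.minimal_in_M1 (marginal \<mu>)"
proof
  assume iso: "solenoid.minimal_in_M1 \<mu>"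
  show "base.minimal_in_M1 (marginal \<mu>)"
    unfolding base.minimal_in_M1_def
  proof (intro ballI allI impI)
    fix \<nu> C assume "\<nu> \<in> M1 M r V" "\<forall>A\<in>sets M. measure \<nu> A \<le> C * measure (marginal \<mu>) A"
    then obtain \<nu>' K where "\<nu>' \<in> Msol" "marginal \<nu>' = \<nu>"
      "\<And>B. B \<in> sets (solenoid_algebra M r) \<Longrightarrow> measure \<nu>' B \<le> K * measure \<mu> B"
      using lift_dominated[OF \<mu>] by metis
    then show "\<nu> = marginal \<mu>"
      using iso unfolding solenoid.minimal_in_M1_def by blast
  qed
next
  assume iso: "base.minimal_in_M1 (marginal \<mu>)"
  show "solenoid.minimal_in_M1 \<mu>"
    unfolding solenoid.minimal_in_M1_def
  proof (intro ballI allI impI)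
    fix \<nu> C assume \<nu>: "\<nu> \<in> Msol"
      and dom: "\<forall>B\<in>sets (solenoid_algebra M r). measure \<nu> B \<le> C * measure \<mu> B"
    have "measure (marginal \<nu>) A \<le> C * measure (marginal \<mu>) A" if A: "A \<in> sets M" for A
    proof -
      have "(\<lambda>x. x 0) -` A \<inter> solenoid M r \<in> sets (solenoid_algebra M r)"
        using measurable_sets[OF measurable_coord A] by (simp add: space_solenoid_algebra)
      from dom[rule_format, OF this] show ?thesis
        using emeasure_cylinder[OF M1D(2)[OF \<mu>] A, of 0] emeasure_cylinder[OF M1D(2)[OF \<nu>] A, of 0]
        by (simp add: measure_def)
    qed
    then have "marginal \<nu> = marginal \<mu>"
      using iso marginal_in_M1[OF \<nu>] unfolding base.minimal_in_M1_def by blast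
    then show "\<nu> = \<mu>" by (rule marginal_determines[OF \<nu> \<mu>])
  qed
qed

end

theorem theorem5p8p8:
  fixes M :: "'a measure" and r :: "'a \<Rightarrow> 'a" and V :: "'a \<Rightarrow> real"
    and \<mu> :: "(nat \<Rightarrow> 'a) measure" and \<mu>\<^sub>0 :: "'a measure"
  assumes "finite_to_one_endo M r"
    and "V \<in> borel_measurable M"
    and "\<And>x. x \<in> space M \<Longrightarrow> 0 \<le> V x"
    and "bounded (V ` space M)"
    and "\<mu> \<in> Mqi1 M r V"
    and "\<mu>\<^sub>0 = distr \<mu> M (\<lambda>x. x 0)"
  shows "\<mu>\<^sub>0 \<in> M1 M r V \<and>
         (extreme_measure \<mu> (Mqi1 M r V)
            \<longleftrightarrow> ergodic (density \<mu> (\<lambda>x. ennreal (V (x 0)))) (rhat r)) \<and>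
         (ergodic (density \<mu> (\<lambda>x. ennreal (V (x 0)))) (rhat r)
            \<longleftrightarrow> extreme_measure \<mu>\<^sub>0 (M1 M r V)) \<and>
         (extreme_measure \<mu>\<^sub>0 (M1 M r V)
            \<longleftrightarrow> relatively_ergodic M r V \<mu>\<^sub>0)"
proof -
  interpret finite_to_one_endo M r by fact
  interpret weighted_finite_to_one_endo M r V
    by unfold_locales (use assms(2-4) r_measurable in auto)
  have \<mu>: "\<mu> \<in> Msol" using assms(5) Mqi1_eq_M1[OF assms(2)] by simp
  have \<mu>\<^sub>0: "\<mu>\<^sub>0 \<in> M1 M r V" unfolding assms(6) by (rule marginal_in_M1[OF \<mu>])
  \<comment> \<open>The shift serves as the measurable left inverse of
    \<open>rhat r\<close>.\<close>
  have "extreme_measure \<mu> (Mqi1 M r V) \<longleftrightarrow> ergodic (density \<mu> (\<lambda>x. ennreal (V (x 0)))) (rhat r)"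
    unfolding Mqi1_eq_M1[OF assms(2)] solenoid.extreme_iff_relatively_ergodic[OF \<mu>]
    by (rule solenoid.relatively_ergodic_iff_ergodic[OF \<mu> measurable_tail tail_rhat])
  \<comment> \<open>Extremality is replaced by minimality on both levels, since it is minimality
    that is transferred along the marginal.\<close>
  moreover have "extreme_measure \<mu> (Mqi1 M r V) \<longleftrightarrow> extreme_measure \<mu>\<^sub>0 (M1 M r V)"
    unfolding Mqi1_eq_M1[OF assms(2)] solenoid.extreme_iff_minimal[OF \<mu>]
      base.extreme_iff_minimal[OF \<mu>\<^sub>0] unfolding assms(6)
    by (rule minimal_marginal_iff[OF \<mu>])
  moreover note base.extreme_iff_relatively_ergodic[OF \<mu>\<^sub>0]
  ultimately show ?thesis using \<mu>\<^sub>0 by blast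
qed

end
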